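(* Let $T>0$, $I=[-T,T]$, and let $f:I\times\mathbb{R}\times\mathbb{R}\times\mathbb{R}\to\mathbb{R}$ be $2T$-periodic in $t$ and a Carathéodory function. Let $(m,M)\in\mathbb{R}^2$ be such that the Green's function $H_{m,M}$ of the periodic problem $$v''(t)+m\,v(-t)+M\,v([t])=\sigma(t)\ \text{ a.e. } t\in I,\qquad v(-T)=v(T),\quad v'(T)=v'(-T)$$ is positive on $I\times I$, and let $L=\max\{H_{m,M}(t,s):(t,s)\in I\times I\}$ and $l=\min\{H_{m,M}(t,s):(t,s)\in I\times I\}$. Assume that there exist $r,R\in\mathbb{R}^+$, $r<R$, such that $$f(t,x,y,z)+my+Mz\geq 0,\quad\forall\,x,y,z\in\left[\tfrac{l}{L}r,\tfrac{L}{l}R\right],\ \text{a.e. } t\in I.$$ If any of the following conditions is satisfied: 1. $f(t,x,y,z)+my+Mz\geq\frac{L}{2Tl^2}\,x$ for all $x,y,z\in\left[\frac{l}{L}r,r\right]$, a.e. $t\in I$, and $f(t,x,y,z)+my+Mz\leq\frac{1}{2TL}\,x$ for all $x,y,z\in\left[R,\frac{L}{l}R\right]$, a.e. $t\in I$; 2. $f(t,x,y,z)+my+Mz\leq\frac{1}{2TL}\,x$ for all $x,y,z\in\left[\frac{l}{L}r,r\right]$, a.e. $t\in I$, and $f(t,x,y,z)+my+Mz\geq\frac{L}{2Tl^2}\,x$ for all $x,y,z\in\left[R,\frac{L}{l}R\right]$, a.e. $t\in I$; then the problem $$v''(t)=f(t,v(t),v(-t),v([t]))\ \text{ a.e. }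 t\in I,\qquad v(-T)=v(T),\quad v'(-T)=v'(T)$$ has a positive solution on $I$.
   Context: The function $[t]$ is truncation towards zero: for $n\in\{0,1,2,\ldots\}$, $[t]=n$ if $t\in[n,n+1)$ and $[t]=-n$ if $t\in(-n-1,-n]$. A solution of either problem is a function $v\in C^1(I)$ with $v'$ absolutely continuous on $I$ that satisfies the equation a.e. and the boundary conditions. The Green's function $H_{m,M}:I\times I\to\mathbb{R}$ is the continuous kernel such that for every $\sigma\in\mathcal{L}^1(I)$ the linear problem has a unique solution, given by $v(t)=\int_{-T}^{T}H_{m,M}(t,s)\sigma(s)\,ds$. Positive means $>0$ at every point (so $l>0$). $f$ is Carathéodory if: for a.e. $t\in I$, $(x,y,z)\mapsto f(t,x,y,z)$ is continuous on $\mathbb{R}^3$; for all $(x,y,z)\in\mathbb{R}^3$, $t\mapsto f(t,x,y,z)$ is Lebesgue measurable on $I$; and for every $\rho>0$ there is $h_\rho\in\mathcal{L}^1(I)$ such that $|f(t,x,y,z)|\leq h_\rho(t)$ for a.e. $t\in I$ whenever $|x|<\rho$, $|y|<\rho$, $|z|<\rho$. Since $t$ ranges in $I=[-T,T]$, $2T$-periodicity means $f(-T,\cdot)=f(T,\cdot)$. *)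

theory Defs
  imports "HOL-Analysis.Analysis"
begin

definition trunc :: "real \<Rightarrow> real" where
  "trunc t = (if t \<ge> 0 then of_int \<lfloor>t\<rfloor> else of_int \<lceil>t\<rceil>)"

lemma trunc_nonneg: "t \<in> {real n..<real n + 1} \<Longrightarrow> trunc t = real n"
proof -
  assume t: "t \<in> {real n..<real n + 1}"
  then have "\<lfloor>t\<rfloor> = int n" by (intro floor_unique) auto
  with t show ?thesis by (auto simp: trunc_def)
qed

lemma trunc_nonpos: "t \<in> {- real n - 1<..- real n} \<Longrightarrow> trunc t = - real n"
proof -
  assume t: "t \<in> {- real n - 1<..- real n}"
  then have "\<lceil>t\<rceil> = - int n" by (intro ceiling_unique) auto
  with t show ?thesis by (cases "t = 0") (auto simp: trunc_def)
qed

text \<open>The library constant \<open>absolutely_continuous\<close> concerns measures; the notion for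
  functions of a real variable is the usual one in terms of finite families of
  non-overlapping subintervals.\<close>

definition abs_continuous_on :: "real set \<Rightarrow> (real \<Rightarrow> real) \<Rightarrow> bool" where
  "abs_continuous_on S w \<longleftrightarrow>
     (\<forall>\<epsilon>>0. \<exists>\<delta>>0. \<forall>(n::nat) a b.
        (\<forall>i<n. a i \<le> b i \<and> {a i..b i} \<subseteq> S) \<and>
        (\<forall>i<n. \<forall>j<n. i \<noteq> j \<longrightarrow> {a i<..<b i} \<inter> {a j<..<b j} = {}) \<and>
        (\<Sum>i<n. b i - a i) < \<delta>
        \<longrightarrow> (\<Sum>i<n. \<bar>w (b i) - w (a i)\<bar>) < \<epsilon>)"

text \<open>\<open>v\<close> is of class \<open>C\<^sup>1\<close> on \<open>[-T, T]\<close> with derivative \<open>v'\<close> (one-sided at the end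
  points), \<open>v'\<close> is absolutely continuous there, and \<open>v''\<close> is its derivative almost
  everywhere. Only the values on \<open>[-T, T]\<close> matter.\<close>

definition derivs_on ::
    "real \<Rightarrow> (real \<Rightarrow> real) \<Rightarrow> (real \<Rightarrow> real) \<Rightarrow> (real \<Rightarrow> real) \<Rightarrow> bool" where
  "derivs_on T v v' v'' \<longleftrightarrow>
     (\<forall>t\<in>{-T..T}. (v has_real_derivative v' t) (at t within {-T..T})) \<and>
     continuous_on {-T..T} v' \<and>
     abs_continuous_on {-T..T} v' \<and>
     (AE t in lebesgue_on {-T..T}. (v' has_real_derivative v'' t) (at t within {-T..T}))"

definition linear_solution ::
    "real \<Rightarrow> real \<Rightarrow> real \<Rightarrow> (real \<Rightarrow> real) \<Rightarrow> (real \<Rightarrow> real) \<Rightarrow> bool" where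
  "linear_solution T m M \<sigma> v \<longleftrightarrow>
     (\<exists>v' v''. derivs_on T v v' v'' \<and>
        (AE t in lebesgue_on {-T..T}. v'' t + m * v (- t) + M * v (trunc t) = \<sigma> t) \<and>
        v (- T) = v T \<and> v' T = v' (- T))"

definition nonlinear_solution ::
    "real \<Rightarrow> (real \<Rightarrow> real \<Rightarrow> real \<Rightarrow> real \<Rightarrow> real) \<Rightarrow> (real \<Rightarrow> real) \<Rightarrow> bool" where
  "nonlinear_solution T f v \<longleftrightarrow>
     (\<exists>v' v''. derivs_on T v v' v'' \<and>
        (AE t in lebesgue_on {-T..T}. v'' t = f t (v t) (v (- t)) (v (trunc t))) \<and>
        v (- T) = v T \<and> v' (- T) = v' T)"

text \<open>Solutions are functions on \<open>[-T, T]\<close>, so uniqueness means agreement there. On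
  \<open>[-T, T] \<times> [-T, T]\<close> there is at most one such continuous kernel \<open>H\<close>.\<close>

definition is_green_function ::
    "real \<Rightarrow> real \<Rightarrow> real \<Rightarrow> (real \<Rightarrow> real \<Rightarrow> real) \<Rightarrow> bool" where
  "is_green_function T m M H \<longleftrightarrow>
     continuous_on ({-T..T} \<times> {-T..T}) (\<lambda>(t, s). H t s) \<and>
     (\<forall>\<sigma>. set_integrable lebesgue {-T..T} \<sigma> \<longrightarrow>
        linear_solution T m M \<sigma> (\<lambda>t. LINT s:{-T..T}|lebesgue. H t s * \<sigma> s) \<and>
        (\<forall>v. linear_solution T m M \<sigma> v \<longrightarrow>
           (\<forall>t\<in>{-T..T}. v t = (LINT s:{-T..T}|lebesgue. H t s * \<sigma> s))))"

definition caratheodory ::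
    "real \<Rightarrow> (real \<Rightarrow> real \<Rightarrow> real \<Rightarrow> real \<Rightarrow> real) \<Rightarrow> bool" where
  "caratheodory T f \<longleftrightarrow>
     (AE t in lebesgue_on {-T..T}. continuous_on UNIV (\<lambda>(x, y, z). f t x y z)) \<and>
     (\<forall>x y z. (\<lambda>t. f t x y z) \<in> borel_measurable (lebesgue_on {-T..T})) \<and>
     (\<forall>\<rho>>0. \<exists>h. set_integrable lebesgue {-T..T} h \<and>
        (\<forall>x y z. \<bar>x\<bar> < \<rho> \<and> \<bar>y\<bar> < \<rho> \<and> \<bar>z\<bar> < \<rho> \<longrightarrow>
           (AE t in lebesgue_on {-T..T}. \<bar>f t x y z\<bar> \<le> h t)))"

end

theory Submission
  imports Defs "HOL-Complex_Analysis.Great_Picard"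
begin

text \<open>
  With \<open>F(t, x, y, z) = f(t, x, y, z) + m y + M z\<close>, positive solutions are the fixed points of
  \<open>A v(t) = \<integral> H(t, s) F(s, v(s), v(-s), v([s])) ds\<close>. Since \<open>l \<le> H \<le> L\<close>, this operator maps
  into the cone of functions \<open>v \<ge> (l / L) max v\<close>, and on the part of the cone with \<open>max v = r\<close>
  or \<open>max v = (L / l) R\<close> the growth conditions compare \<open>max (A v)\<close> with \<open>max v\<close>: compression
  under condition 1, expansion under condition 2. Both cases are reduced to Schauder's theorem by
  an additional real unknown \<open>\<mu>\<close> that prescribes \<open>max v\<close>. Schauder's theorem in \<open>C(S)\<close> follows
  from Brouwer's theorem on \<open>[0, 1]\<^sup>n\<close> (for all natural numbers \<open>n\<close>, from Kuhn's combinatorial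
  lemma) and the Arzela-Ascoli theorem.
\<close>

section \<open>Brouwer and Schauder fixed points\<close>

text \<open>Points of the cube are sequences of which the first \<open>n\<close> coordinates count,
  so that \<open>n\<close> is an arbitrary number and not the dimension of a type. Kuhn's lemma on
  the grid of mesh \<open>1 / Suc k\<close> yields a cell in which, for each \<open>i\<close>, some
  vertex is not moved down and some vertex is not moved up in coordinate \<open>i\<close>. As the
  mesh shrinks, the cells accumulate at a fixed point.\<close>

lemma brouwer_nat_cube:
  fixes g :: "(nat \<Rightarrow> real) \<Rightarrow> nat \<Rightarrow> real"
  assumes range: "\<And>a i. \<forall>j<n. a j \<in> {0..1} \<Longrightarrow> i < n \<Longrightarrow> g a i \<in> {0..1}"
    and cont: "\<And>a b i. \<forall>k. \<forall>j<n. a k j \<in> {0..1} \<Longrightarrow> \<forall>j<n. (\<lambda>k. a k j) \<longlonglongrightarrow> b j \<Longrightarrow> i < n \<Longrightarrow>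
                (\<lambda>k. g (a k) i) \<longlonglongrightarrow> g b i"
  obtains b where "\<forall>i<n. b i \<in> {0..1}" "\<forall>i<n. g b i = b i"
proof -
  define sc where "sc k x = (\<lambda>j. real (x j) / real (Suc k))" for k and x :: "nat \<Rightarrow> nat"
  \<comment> \<open>Label 0 records that \<open>g\<close> does not decrease coordinate
    \<open>i\<close>. On the face \<open>x i = Suc k\<close> Kuhn's lemma demands label 1, which is
    consistent because there the scaled coordinate is 1 and \<open>g\<close> cannot exceed
    it.\<close>
  define label where
    "label k x i = (if x i \<noteq> Suc k \<and> sc k x i \<le> g (sc k x) i then 0 else 1::nat)" for k x i
  have sc01: "sc k x j \<in> {0..1}" if "x j \<le> Suc k" for k x j
    using that by (auto simp: sc_def divide_simps)
  have label0: "sc k x i \<le> g (sc k x) i" if "label k x i = 0" for k x i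
    using that by (auto simp: label_def split: if_splits)
  have label1: "g (sc k x) i \<le> sc k x i"
    if "label k x i \<noteq> 0" "\<forall>j<n. x j \<le> Suc k" "i < n" for k x i
  proof (cases "x i = Suc k")
    case True
    then have "sc k x i = 1" by (simp add: sc_def)
    then show ?thesis using range[of "sc k x" i] sc01 that by auto
  next
    case False
    with that show ?thesis by (auto simp: label_def split: if_splits)
  qed
  define near where "near q x \<longleftrightarrow> (\<forall>j<n. q j \<le> x j \<and> x j \<le> q j + 1)" for q x :: "nat \<Rightarrow> nat"
  have "\<exists>q. (\<forall>i<n. q i < Suc k) \<and>
    (\<forall>i<n. \<exists>u w. near q u \<and> near q w \<and> label k u i = 0 \<and> label k w i \<noteq> 0)" for k
  proof -
    have "0 < Suc k" by simp
    moreover have "\<forall>x. (\<forall>i<n. x i \<le> Suc k) \<longrightarrow> (\<forall>i<n. label k x i = 0 \<or> label k x i = 1)"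
      by (auto simp: label_def)
    moreover have "\<forall>x. (\<forall>i<n. x i \<le> Suc k) \<longrightarrow> (\<forall>i<n. x i = 0 \<longrightarrow> label k x i = 0)"
    proof (intro allI impI)
      fix x i assume *: "\<forall>i<n. x i \<le> Suc k" "i < n" "x i = 0"
      then have "g (sc k x) i \<in> {0..1}" using sc01 by (intro range) blast+
      with * show "label k x i = 0" by (simp add: label_def) (simp add: sc_def)
    qed
    moreover have "\<forall>x. (\<forall>i<n. x i \<le> Suc k) \<longrightarrow> (\<forall>i<n. x i = Suc k \<longrightarrow> label k x i = 1)"
      by (auto simp: label_def)
    ultimately obtain q where q: "\<forall>i<n. q i < Suc k"
      "\<forall>i<n. \<exists>u w. (\<forall>j<n. q j \<le> u j \<and> u j \<le> q j + 1) \<and>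
         (\<forall>j<n. q j \<le> w j \<and> w j \<le> q j + 1) \<and> label k u i \<noteq> label k w i"
      by (rule kuhn_lemma)
    have "\<exists>u w. near q u \<and> near q w \<and> label k u i = 0 \<and> label k w i \<noteq> 0" if i: "i < n" for i
    proof -
      obtain u w where "near q u" "near q w" "label k u i \<noteq> label k w i"
        using q(2) i unfolding near_def by blast
      moreover have "label k u i = 0 \<or> label k w i = 0"
        using \<open>label k u i \<noteq> label k w i\<close> by (auto simp: label_def split: if_splits)
      ultimately show ?thesis by metis
    qed
    with q(1) show ?thesis by blast
  qed
  then obtain q where q: "\<And>k i. i < n \<Longrightarrow> q k i < Suc k"
    and uw: "\<And>k i. i < n \<Longrightarrow>
      \<exists>u w. near (q k) u \<and> near (q k) w \<and> label k u i = 0 \<and> label k w i \<noteq> 0"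
    by metis
  \<comment> \<open>The pair \<open>u k i\<close>, \<open>w k i\<close> consists of a vertex
    labelled 0 and a vertex labelled otherwise, both in the cell with lowest corner
    \<open>q k\<close>.\<close>
  define Q where "Q k i p \<longleftrightarrow> near (q k) (fst p) \<and> near (q k) (snd p) \<and>
      label k (fst p) i = 0 \<and> label k (snd p) i \<noteq> 0" for k i p
  define u where "u k i = fst (SOME p. Q k i p)" for k i
  define w where "w k i = snd (SOME p. Q k i p)" for k i
  have "Q k i (SOME p. Q k i p)" if "i < n" for k i
    using uw[OF that, of k] by (intro someI_ex[of "Q k i"]) (auto simp: Q_def)
  then have u: "\<And>k i. i < n \<Longrightarrow> near (q k) (u k i)" "\<And>k i. i < n \<Longrightarrow> label k (u k i) i = 0"
    and w: "\<And>k i. i < n \<Longrightarrow> near (q k) (w k i)" "\<And>k i. i < n \<Longrightarrow> label k (w k i) i \<noteq> 0"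
    unfolding Q_def u_def w_def by blast+
  have near_le: "\<forall>j<n. x j \<le> Suc k" if "near (q k) x" for x k
    using that q unfolding near_def by (metis Suc_eq_plus1 Suc_leI le_trans)
  \<comment> \<open>Padding with zeros puts the corners into the product of countably many unit
    intervals. Tychonoff's theorem then gives one subsequence that converges in all
    coordinates.\<close>
  define x where "x k = (\<lambda>j. if j < n then sc k (q k) j else 0)" for k
  have "compact (PiE UNIV (\<lambda>_::nat. {0..1::real}))"
    using compactin_PiE[of "\<lambda>_::nat. euclidean :: real topology" UNIV "\<lambda>_. {0..1}"]
    by (simp add: euclidean_product_topology)
  moreover have "x k \<in> PiE UNIV (\<lambda>_::nat. {0..1::real})" for k
    using sc01[of "q k" _ k] q[of _ k] by (auto simp: x_def less_imp_le)
  ultimately obtain b \<phi> where b: "b \<in> PiE UNIV (\<lambda>_::nat. {0..1::real})" and \<phi>: "strict_mono \<phi>"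
    and lim: "(x \<circ> \<phi>) \<longlonglongrightarrow> b"
    using seq_compactE[of "PiE UNIV (\<lambda>_::nat. {0..1::real})" x] by (metis compact_imp_seq_compact)
  have limx: "(\<lambda>k. x (\<phi> k) j) \<longlonglongrightarrow> b j" for j
    using continuous_on_tendsto_compose[OF continuous_on_product_coordinates lim, where i1 = j]
    by (simp add: o_def)
  have inv0: "(\<lambda>k. 1 / real (Suc (\<phi> k))) \<longlonglongrightarrow> 0"
    using LIMSEQ_subseq_LIMSEQ[OF LIMSEQ_inverse_real_of_nat \<phi>] by (simp add: o_def inverse_eq_divide)
  \<comment> \<open>Vertices of a cell differ from its corner by at most \<open>1 / Suc k\<close> in
    each coordinate, so every choice of vertices has the same limit \<open>b\<close>.\<close>
  have near_lim: "(\<lambda>k. sc (\<phi> k) (y (\<phi> k)) j) \<longlonglongrightarrow> b j"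
    if y: "\<And>k. near (q k) (y k)" and j: "j < n" for y j
  proof -
    have "(\<lambda>k. sc (\<phi> k) (y (\<phi> k)) j - x (\<phi> k) j) \<longlonglongrightarrow> 0"
    proof (rule Lim_null_comparison[OF always_eventually inv0], intro allI)
      fix k
      have "q (\<phi> k) j \<le> y (\<phi> k) j" "y (\<phi> k) j \<le> q (\<phi> k) j + 1"
        using y[of "\<phi> k"] j by (auto simp: near_def)
      then show "norm (sc (\<phi> k) (y (\<phi> k)) j - x (\<phi> k) j) \<le> 1 / real (Suc (\<phi> k))"
        using j by (simp add: sc_def x_def flip: diff_divide_distrib) (simp add: divide_simps)
    qed
    from tendsto_add[OF this limx[of j]] show ?thesis by simp
  qed
  have "g b i = b i" if i: "i < n" for i
  proof (rule antisym)
    have g_lim: "(\<lambda>k. g (sc (\<phi> k) (w (\<phi> k) i)) i) \<longlonglongrightarrow> g b i"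
      using near_lim[of "\<lambda>k. w k i"] w(1)[OF i] i near_le sc01 by (intro cont) blast+
    have "g (sc (\<phi> k) (w (\<phi> k) i)) i \<le> sc (\<phi> k) (w (\<phi> k) i) i" for k
      by (intro label1 near_le w i)
    then show "g b i \<le> b i"
      using LIMSEQ_le[OF g_lim near_lim[OF w(1)[OF i] i]] by blast
    have g_lim: "(\<lambda>k. g (sc (\<phi> k) (u (\<phi> k) i)) i) \<longlonglongrightarrow> g b i"
      using near_lim[of "\<lambda>k. u k i"] u(1)[OF i] i near_le sc01 by (intro cont) blast+
    have "sc (\<phi> k) (u (\<phi> k) i) i \<le> g (sc (\<phi> k) (u (\<phi> k) i)) i" for k
      by (intro label0 u i)
    then show "b i \<le> g b i"
      using LIMSEQ_le[OF near_lim[OF u(1)[OF i] i] g_lim] by blast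
  qed
  with b show ?thesis by (intro that[of b]) auto
qed

text \<open>This encodes a continuous map of C(S) into itself with relatively compact range. The
  bound and the modulus of continuity are uniform over all of C(S), so no invariant convex set has
  to be carried along. Pointwise convergence suffices as continuity, because equicontinuity makes up
  for the rest.\<close>

locale compact_self_map =
  fixes S :: "'a::euclidean_space set" and \<Phi> :: "('a \<Rightarrow> real) \<Rightarrow> 'a \<Rightarrow> real" and B :: real
  assumes compact: "compact S"
    and bounded: "continuous_on S w \<Longrightarrow> x \<in> S \<Longrightarrow> \<bar>\<Phi> w x\<bar> \<le> B"
    and equicontinuous: "0 < e \<Longrightarrow> \<exists>d>0. \<forall>w. continuous_on S w \<longrightarrow>
           (\<forall>x\<in>S. \<forall>y\<in>S. dist x y < d \<longrightarrow> \<bar>\<Phi> w x - \<Phi> w y\<bar> < e)"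
    and continuous: "(\<And>n. continuous_on S (v n)) \<Longrightarrow> continuous_on S w \<Longrightarrow>
           uniform_limit S v w sequentially \<Longrightarrow> x \<in> S \<Longrightarrow> (\<lambda>n. \<Phi> (v n) x) \<longlonglongrightarrow> \<Phi> w x"
begin

text \<open>Brouwer's theorem is applied to the values on the net: \<open>P a\<close> interpolates
  the rescaled coefficients \<open>a\<close>, and \<open>g\<close> reads off \<Phi> of this
  interpolant at the net points. At a fixed point \<open>b\<close>, \<open>P b\<close> is a weighted
  mean of values of \<open>\<Phi> (P b)\<close> at net points. Those at distance at least
  \<open>d\<close> from \<open>x\<close> have weight zero, and the others differ from
  \<open>\<Phi> (P b) x\<close> by less than \<open>e\<close>.\<close>

lemma approximate_fixed_point:
  assumes "0 < e"
  obtains w where "continuous_on S w" "\<forall>x\<in>S. \<bar>\<Phi> w x - w x\<bar> \<le> e"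
proof -
  obtain d where "0 < d" and equi: "\<forall>w. continuous_on S w \<longrightarrow>
      (\<forall>x\<in>S. \<forall>y\<in>S. dist x y < d \<longrightarrow> \<bar>\<Phi> w x - \<Phi> w y\<bar> < e)"
    using equicontinuous[OF assms] by blast
  then have d: "\<bar>\<Phi> w x - \<Phi> w y\<bar> < e" if "continuous_on S w" "x \<in> S" "y \<in> S" "dist x y < d" for w x y
    using that by blast
  obtain K where K: "finite K" "K \<subseteq> S" "S \<subseteq> (\<Union>x\<in>K. ball x d)"
  proof (rule compactE_image[OF compact, of S "\<lambda>x. ball x d"])
    show "S \<subseteq> (\<Union>x\<in>S. ball x d)" using \<open>0 < d\<close> by auto
  qed auto
  obtain X and n :: nat where "K = X ` {i. i < n}"
    using finite_imp_nat_seg_image_inj_on[OF K(1)] by blast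
  with K have XS: "X i \<in> S" if "i < n" for i
    using that by blast
  have net: "\<exists>i<n. dist (X i) x < d" if "x \<in> S" for x
  proof -
    from K(3) that obtain y where "y \<in> K" "dist y x < d" by auto
    with \<open>K = X ` {i. i < n}\<close> show ?thesis by auto
  qed
  text \<open>The Schauder projection: a function is replaced by the combination of its values on a
    finite net with a subordinate partition of unity.\<close>
  define hat where "hat i x = max 0 (d - dist (X i) x)" for i x
  define tot where "tot x = (\<Sum>i<n. hat i x)" for x
  have tot: "0 < tot x" if x: "x \<in> S" for x
  proof -
    obtain i where "i < n" "dist (X i) x < d" using net[OF x] by blast
    then show ?thesis unfolding tot_def hat_def by (intro sum_pos2[of _ i]) auto
  qed
  define \<phi> where "\<phi> i x = hat i x / tot x" for i x
  have \<phi>_nonneg: "0 \<le> \<phi> i x" if "x \<in> S" for i x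
    using tot[OF that] by (simp add: \<phi>_def hat_def)
  have \<phi>_sum: "(\<Sum>i<n. \<phi> i x) = 1" if "x \<in> S" for x
    using tot[OF that] by (simp add: \<phi>_def tot_def flip: sum_divide_distrib)
  have \<phi>_le: "\<phi> i x \<le> 1" if "x \<in> S" "i < n" for i x
    using member_le_sum[of i "{..<n}" "\<lambda>i. \<phi> i x"] \<phi>_nonneg \<phi>_sum that by auto
  have \<phi>_cont: "continuous_on S (\<phi> i)" for i
    unfolding \<phi>_def hat_def tot_def
    using tot by (intro continuous_intros) (auto simp: tot_def hat_def less_imp_neq[symmetric])
  \<comment> \<open>The map \<open>a \<mapsto> 2 * C * a - C\<close> carries [0, 1] onto [-C, C],
    which contains all values of \<Phi> on S. The summand 1 makes \<open>C\<close> positive.\<close>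
  define C where "C = \<bar>B\<bar> + 1"
  have C: "0 < C" "B \<le> C" by (auto simp: C_def)
  define P where "P a x = (\<Sum>i<n. \<phi> i x * (2 * C * a i - C))" for a x
  define g where "g a i = (\<Phi> (P a) (X i) + C) / (2 * C)" for a i
  have P_cont: "continuous_on S (P a)" for a
    unfolding P_def by (intro continuous_intros \<phi>_cont)
  have g01: "g a i \<in> {0..1}" if "i < n" for a i
    using bounded[OF P_cont XS[OF that], of a] C by (auto simp: g_def divide_simps)
  have P_lim: "uniform_limit S (\<lambda>k. P (a k)) (P b) sequentially"
    if lim: "\<forall>j<n. (\<lambda>k. a k j) \<longlonglongrightarrow> b j" for a b
  proof (rule uniform_limitI)
    fix \<epsilon> :: real assume "0 < \<epsilon>"
    have "(\<lambda>k. \<Sum>i<n. 2 * C * \<bar>a k i - b i\<bar>) \<longlonglongrightarrow> (\<Sum>i<n. 2 * C * \<bar>b i - b i\<bar>)"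
      using lim by (intro tendsto_intros) auto
    then have "\<forall>\<^sub>F k in sequentially. (\<Sum>i<n. 2 * C * \<bar>a k i - b i\<bar>) < \<epsilon>"
      using order_tendstoD(2) \<open>0 < \<epsilon>\<close> by fastforce
    then show "\<forall>\<^sub>F k in sequentially. \<forall>x\<in>S. dist (P (a k) x) (P b x) < \<epsilon>"
    proof eventually_elim
      case (elim k)
      show ?case
      proof
        fix x assume x: "x \<in> S"
        have "P (a k) x - P b x = (\<Sum>i<n. \<phi> i x * (2 * C * (a k i - b i)))"
          by (simp add: P_def algebra_simps flip: sum_subtractf)
        also have "\<bar>\<dots>\<bar> \<le> (\<Sum>i<n. \<bar>\<phi> i x * (2 * C * (a k i - b i))\<bar>)"
          by (rule sum_abs)
        also have "\<dots> \<le> (\<Sum>i<n. 2 * C * \<bar>a k i - b i\<bar>)"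
        proof (rule sum_mono)
          fix i assume "i \<in> {..<n}"
          then have "\<phi> i x * (2 * C * \<bar>a k i - b i\<bar>) \<le> 1 * (2 * C * \<bar>a k i - b i\<bar>)"
            using \<phi>_le[OF x] C by (intro mult_right_mono) auto
          then show "\<bar>\<phi> i x * (2 * C * (a k i - b i))\<bar> \<le> 2 * C * \<bar>a k i - b i\<bar>"
            using \<phi>_nonneg[OF x, of i] C by (simp add: abs_mult)
        qed
        finally show "dist (P (a k) x) (P b x) < \<epsilon>"
          using elim by (simp add: dist_real_def)
      qed
    qed
  qed
  have g_cont: "(\<lambda>k. g (a k) i) \<longlonglongrightarrow> g b i"
    if "\<forall>j<n. (\<lambda>k. a k j) \<longlonglongrightarrow> b j" "i < n" for a b i
    unfolding g_def using continuous[OF P_cont P_cont P_lim[OF that(1)] XS[OF that(2)]] C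
    by (intro tendsto_intros) auto
  obtain b where b: "\<forall>i<n. g b i = b i"
    using brouwer_nat_cube[of n g] g01 g_cont by metis
  have b_eq: "2 * C * b i - C = \<Phi> (P b) (X i)" if "i < n" for i
    using b that C by (auto simp: g_def field_simps)
  show ?thesis
  proof (rule that[OF P_cont], intro ballI)
    fix x assume x: "x \<in> S"
    have "\<Phi> (P b) x - P b x = (\<Sum>i<n. \<phi> i x) * \<Phi> (P b) x - (\<Sum>i<n. \<phi> i x * \<Phi> (P b) (X i))"
      using \<phi>_sum[OF x] b_eq by (simp add: P_def)
    also have "\<dots> = (\<Sum>i<n. \<phi> i x * (\<Phi> (P b) x - \<Phi> (P b) (X i)))"
      by (simp add: algebra_simps sum_distrib_left flip: sum_subtractf)
    also have "\<bar>\<dots>\<bar> \<le> (\<Sum>i<n. \<bar>\<phi> i x * (\<Phi> (P b) x - \<Phi> (P b) (X i))\<bar>)"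
      by (rule sum_abs)
    also have "\<dots> \<le> (\<Sum>i<n. \<phi> i x * e)"
    proof (rule sum_mono)
      fix i assume i: "i \<in> {..<n}"
      show "\<bar>\<phi> i x * (\<Phi> (P b) x - \<Phi> (P b) (X i))\<bar> \<le> \<phi> i x * e"
      proof (cases "dist (X i) x < d")
        case True
        then have "\<bar>\<Phi> (P b) x - \<Phi> (P b) (X i)\<bar> \<le> e"
          using d[OF P_cont x XS, of i b] i by (simp add: dist_commute)
        then show ?thesis using \<phi>_nonneg[OF x, of i] by (simp add: abs_mult mult_left_mono)
      qed (simp add: \<phi>_def hat_def)
    qed
    also have "\<dots> = e" using \<phi>_sum[OF x] by (simp flip: sum_distrib_right)
    finally show "\<bar>\<Phi> (P b) x - P b x\<bar> \<le> e" .
  qed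
qed

text \<open>By Arzela-Ascoli the images of ever better approximate fixed points converge uniformly
  along a subsequence. The approximate fixed points themselves then have the same limit, which
  continuity turns into a fixed point.\<close>

theorem schauder_fixed_point:
  obtains w where "continuous_on S w" "\<forall>x\<in>S. \<Phi> w x = w x"
proof -
  have "\<exists>w. continuous_on S w \<and> (\<forall>x\<in>S. \<bar>\<Phi> w x - w x\<bar> \<le> inverse (real (Suc n)))" for n
    by (metis approximate_fixed_point inverse_positive_iff_positive of_nat_0_less_iff zero_less_Suc)
  then obtain v where v: "\<And>n. continuous_on S (v n)"
    "\<And>n x. x \<in> S \<Longrightarrow> \<bar>\<Phi> (v n) x - v n x\<bar> \<le> inverse (real (Suc n))"
    by metis
  obtain w and k :: "nat \<Rightarrow> nat" where w: "continuous_on S w" and k: "strict_mono k"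
    and conv: "\<And>e. 0 < e \<Longrightarrow> \<exists>N. \<forall>n x. n \<ge> N \<and> x \<in> S \<longrightarrow> norm (\<Phi> (v (k n)) x - w x) < e"
  proof (rule Arzela_Ascoli[of S "\<lambda>n. \<Phi> (v n)" B])
    show "compact S" by (rule compact)
    show "norm (\<Phi> (v n) x) \<le> B" if "x \<in> S" for n x
      using bounded[OF v(1) that] by simp
    show "\<exists>d>0. \<forall>n y. y \<in> S \<and> norm (x - y) < d \<longrightarrow> norm (\<Phi> (v n) x - \<Phi> (v n) y) < e"
      if "x \<in> S" "0 < e" for x e
      using equicontinuous[OF that(2)] that(1) v(1) by (metis dist_norm real_norm_def)
  qed (rule that)
  have lim_\<Phi>: "uniform_limit S (\<lambda>n. \<Phi> (v (k n))) w sequentially"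
    unfolding uniform_limit_sequentially_iff dist_norm using conv by blast
  have lim_diff: "uniform_limit S (\<lambda>n x. v (k n) x - \<Phi> (v (k n)) x) (\<lambda>_. 0) sequentially"
  proof (rule uniform_limitI)
    fix e :: real assume "0 < e"
    have "(\<lambda>n. inverse (real (Suc (k n)))) \<longlonglongrightarrow> 0"
      using LIMSEQ_subseq_LIMSEQ[OF LIMSEQ_inverse_real_of_nat k] by (simp add: o_def)
    then have "\<forall>\<^sub>F n in sequentially. inverse (real (Suc (k n))) < e"
      using order_tendstoD(2) \<open>0 < e\<close> by blast
    then show "\<forall>\<^sub>F n in sequentially. \<forall>x\<in>S. dist (v (k n) x - \<Phi> (v (k n)) x) 0 < e"
    proof eventually_elim
      case (elim n)
      show ?case
      proof
        fix x assume "x \<in> S"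
        then show "dist (v (k n) x - \<Phi> (v (k n)) x) 0 < e"
          using v(2)[of x "k n"] elim by (simp add: dist_norm abs_minus_commute)
      qed
    qed
  qed
  have "uniform_limit S (\<lambda>n. v (k n)) w sequentially"
    using uniform_limit_add[OF lim_diff lim_\<Phi>] by simp
  then have "(\<lambda>n. \<Phi> (v (k n)) x) \<longlonglongrightarrow> \<Phi> w x" if "x \<in> S" for x
    using that v(1) w by (intro continuous)
  moreover have "(\<lambda>n. \<Phi> (v (k n)) x) \<longlonglongrightarrow> w x" if "x \<in> S" for x
    using tendsto_uniform_limitI[OF lim_\<Phi> that] .
  ultimately show ?thesis
    using w by (intro that) (auto intro: LIMSEQ_unique)
qed

end

section \<open>Compression and expansion of a cone\<close>

lemma continuous_Icc_Sup:
  fixes v :: "real \<Rightarrow> real"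
  assumes "a \<le> b" "continuous_on {a..b} v"
  obtains s where "s \<in> {a..b}" "v s = Sup (v ` {a..b})" "\<And>t. t \<in> {a..b} \<Longrightarrow> v t \<le> Sup (v ` {a..b})"
proof -
  obtain s where s: "s \<in> {a..b}" "\<And>t. t \<in> {a..b} \<Longrightarrow> v t \<le> v s"
    using continuous_attains_sup[of "{a..b}" v] assms by auto
  then have "Sup (v ` {a..b}) = v s"
    by (intro cSup_eq_maximum) auto
  with s show ?thesis by (intro that[of s]) auto
qed

lemma Sup_diff_le:
  fixes v w :: "real \<Rightarrow> real"
  assumes "a \<le> b" "continuous_on {a..b} v" "continuous_on {a..b} w"
    and close: "\<And>t. t \<in> {a..b} \<Longrightarrow> \<bar>v t - w t\<bar> \<le> e"
  shows "\<bar>Sup (v ` {a..b}) - Sup (w ` {a..b})\<bar> \<le> e"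
proof -
  obtain p where p: "p \<in> {a..b}" "v p = Sup (v ` {a..b})" "\<And>t. t \<in> {a..b} \<Longrightarrow> v t \<le> Sup (v ` {a..b})"
    using continuous_Icc_Sup assms by blast
  obtain q where q: "q \<in> {a..b}" "w q = Sup (w ` {a..b})" "\<And>t. t \<in> {a..b} \<Longrightarrow> w t \<le> Sup (w ` {a..b})"
    using continuous_Icc_Sup assms by blast
  show ?thesis
    using close[OF p(1)] close[OF q(1)] p(2) q(2) p(3)[OF q(1)] q(3)[OF p(1)] by linarith
qed

lemma tendsto_Sup_uniform:
  fixes v :: "nat \<Rightarrow> real \<Rightarrow> real"
  assumes "a \<le> b" "\<And>n. continuous_on {a..b} (v n)" "continuous_on {a..b} w"
    and lim: "uniform_limit {a..b} v w sequentially"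
  shows "(\<lambda>n. Sup (v n ` {a..b})) \<longlonglongrightarrow> Sup (w ` {a..b})"
proof (rule tendstoI)
  fix e :: real assume "0 < e"
  then have "\<forall>\<^sub>F n in sequentially. \<forall>t\<in>{a..b}. dist (v n t) (w t) < e / 2"
    using lim by (intro uniform_limitD) auto
  then show "\<forall>\<^sub>F n in sequentially. dist (Sup (v n ` {a..b})) (Sup (w ` {a..b})) < e"
  proof eventually_elim
    case (elim n)
    then have "\<bar>Sup (v n ` {a..b}) - Sup (w ` {a..b})\<bar> \<le> e / 2"
      using assms by (intro Sup_diff_le) (auto simp: dist_real_def less_imp_le)
    with \<open>0 < e\<close> show ?case by (simp add: dist_real_def)
  qed
qed

text \<open>For nonnegative \<kappa> and \<open>r\<close> and a nonempty interval these functions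
  are nonnegative there, so the supremum is their norm in C([a, b]) and \<open>r\<close>,
  \<open>R\<close> are radii.\<close>

definition cone_annulus :: "real \<Rightarrow> real \<Rightarrow> real \<Rightarrow> real \<Rightarrow> real \<Rightarrow> (real \<Rightarrow> real) set" where
  "cone_annulus a b \<kappa> r R = {v. continuous_on {a..b} v \<and> Sup (v ` {a..b}) \<in> {r..R} \<and>
     (\<forall>t\<in>{a..b}. \<kappa> * Sup (v ` {a..b}) \<le> v t)}"

text \<open>The operator respects the cone but may leave the annulus, so Schauder's theorem does not
  apply to it directly. Treating the maximum as an independent unknown removes this obstacle:
  \<open>A\<close> is evaluated only at the retracted function \<open>\<rho> w\<close>, which always
  lies in \<open>K\<close>. The boundary condition then forces the prescribed maximum and the actual
  one to agree at a fixed point.\<close>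

theorem krasnoselskii_fixed_point:
  fixes A :: "(real \<Rightarrow> real) \<Rightarrow> real \<Rightarrow> real" and a b \<kappa> r R B :: real
  defines "K \<equiv> cone_annulus a b \<kappa> r R"
  assumes ab: "a \<le> b" and \<kappa>: "0 \<le> \<kappa>" "\<kappa> \<le> 1" and r: "0 \<le> r" "r \<le> R"
    and bounded: "\<And>v t. v \<in> K \<Longrightarrow> t \<in> {a..b} \<Longrightarrow> \<bar>A v t\<bar> \<le> B"
    and cone: "\<And>v t. v \<in> K \<Longrightarrow> t \<in> {a..b} \<Longrightarrow> \<kappa> * Sup (A v ` {a..b}) \<le> A v t"
    and equicontinuous: "\<And>e. 0 < e \<Longrightarrow> \<exists>d>0. \<forall>v\<in>K. \<forall>s\<in>{a..b}. \<forall>t\<in>{a..b}.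
           dist s t < d \<longrightarrow> \<bar>A v s - A v t\<bar> < e"
    and continuous: "\<And>v w. (\<And>n. v n \<in> K) \<Longrightarrow> w \<in> K \<Longrightarrow> uniform_limit {a..b} v w sequentially \<Longrightarrow>
           uniform_limit {a..b} (\<lambda>n. A (v n)) (A w) sequentially"
    and boundary:
      "(\<forall>v\<in>K. (Sup (v ` {a..b}) = r \<longrightarrow> r \<le> Sup (A v ` {a..b})) \<and>
               (Sup (v ` {a..b}) = R \<longrightarrow> Sup (A v ` {a..b}) \<le> R)) \<or>
       (\<forall>v\<in>K. (Sup (v ` {a..b}) = r \<longrightarrow> Sup (A v ` {a..b}) \<le> r) \<and>
               (Sup (v ` {a..b}) = R \<longrightarrow> R \<le> Sup (A v ` {a..b})))"
  obtains v where "v \<in> K" "\<And>t. t \<in> {a..b} \<Longrightarrow> A v t = v t"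
proof -
  define peak where "peak v = Sup (v ` {a..b})" for v :: "real \<Rightarrow> real"
  obtain \<epsilon> :: real where \<epsilon>: "(\<epsilon> = 1 \<and> (\<forall>v\<in>K. (peak v = r \<longrightarrow> r \<le> peak (A v)) \<and> (peak v = R \<longrightarrow> peak (A v) \<le> R))) \<or>
      (\<epsilon> = -1 \<and> (\<forall>v\<in>K. (peak v = r \<longrightarrow> peak (A v) \<le> r) \<and> (peak v = R \<longrightarrow> R \<le> peak (A v))))"
    using boundary unfolding peak_def by blast
  text \<open>The isolated point \<open>b + 1\<close> carries the additional unknown \<open>\<mu>\<close>. The function \<open>\<rho> w\<close> lies
    in the cone, has maximum \<open>\<mu>\<close>, and agrees with \<open>w\<close> if \<open>w\<close> is itself an element of the cone with
    maximum \<open>\<mu>\<close>. The sign \<open>\<epsilon>\<close> makes \<open>\<mu>\<close> move inwards at both ends of \<open>[r, R]\<close>.\<close>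
  define S where "S = {a..b} \<union> {b + 1}"
  define clip where "clip = (\<lambda>x. max r (min R x))"
  define \<mu> where "\<mu> w = clip (w (b + 1))" for w :: "real \<Rightarrow> real"
  define \<rho> where "\<rho> w = (\<lambda>t. max (w t + (\<mu> w - peak w)) (\<kappa> * \<mu> w))" for w
  define \<Phi> where "\<Phi> w t = (if t \<le> b then A (\<rho> w) t else clip (\<mu> w + \<epsilon> * (peak (A (\<rho> w)) - \<mu> w)))" for w t
  have clip: "clip x \<in> {r..R}" for x
    using r by (auto simp: clip_def)
  have clip_lip: "\<bar>clip x - clip y\<bar> \<le> \<bar>x - y\<bar>" for x y
    using r by (auto simp: clip_def)
  have \<mu>: "\<mu> w \<in> {r..R}" for w
    unfolding \<mu>_def by (rule clip)
  have S_sub: "continuous_on {a..b} w" if "continuous_on S w" for w :: "real \<Rightarrow> real"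
    using that by (rule continuous_on_subset) (auto simp: S_def)
  have \<rho>: "\<rho> w \<in> K" "peak (\<rho> w) = \<mu> w" if "continuous_on S w" for w
  proof -
    have w: "continuous_on {a..b} w" by (rule S_sub[OF that])
    obtain s where s: "s \<in> {a..b}" "w s = peak w" "\<And>t. t \<in> {a..b} \<Longrightarrow> w t \<le> peak w"
      using continuous_Icc_Sup[OF ab w] unfolding peak_def by blast
    \<comment> \<open>The shift by \<open>\<mu> w - peak w\<close> moves the maximum to
      \<open>\<mu> w\<close>. Cutting off from below at \<open>\<kappa> * \<mu> w\<close> does not
      raise it, because \<kappa> is at most 1 and \<open>\<mu> w\<close> is nonnegative.\<close>
    have "\<kappa> * \<mu> w \<le> 1 * \<mu> w" using \<kappa> \<mu>[of w] r by (intro mult_right_mono) auto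
    then show peak_\<rho>: "peak (\<rho> w) = \<mu> w"
      unfolding peak_def[of "\<rho> w"] using s by (intro cSup_eq_maximum) (force simp: \<rho>_def)+
    have "continuous_on {a..b} (\<rho> w)" unfolding \<rho>_def by (intro continuous_intros w)
    then show "\<rho> w \<in> K" using peak_\<rho> \<mu>[of w]
      by (auto simp: K_def cone_annulus_def \<rho>_def[of w] peak_def[symmetric])
  qed
  have A_cont: "continuous_on {a..b} (A v)" if "v \<in> K" for v
    unfolding continuous_on_iff
  proof (intro ballI allI impI)
    fix s e :: real assume "s \<in> {a..b}" "0 < e"
    with equicontinuous[OF this(2)] that
    show "\<exists>d>0. \<forall>t\<in>{a..b}. dist t s < d \<longrightarrow> dist (A v t) (A v s) < e"
      unfolding dist_real_def by blast
  qed
  have \<rho>_lim: "uniform_limit {a..b} (\<lambda>n. \<rho> (v n)) (\<rho> w) sequentially"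
    if v: "\<And>n. continuous_on S (v n)" and w: "continuous_on S w" and lim: "uniform_limit S v w sequentially"
    for v w
  proof (rule uniform_limitI)
    fix e :: real assume "0 < e"
    then have "\<forall>\<^sub>F n in sequentially. \<forall>t\<in>S. dist (v n t) (w t) < e / 4"
      using lim by (intro uniform_limitD) auto
    then show "\<forall>\<^sub>F n in sequentially. \<forall>t\<in>{a..b}. dist (\<rho> (v n) t) (\<rho> w t) < e"
    proof eventually_elim
      case (elim n)
      then have close: "\<bar>v n t - w t\<bar> \<le> e / 4" if "t \<in> S" for t
        using that by (auto simp: dist_real_def less_imp_le)
      have \<mu>_close: "\<bar>\<mu> (v n) - \<mu> w\<bar> \<le> e / 4"
        using clip_lip[of "v n (b + 1)" "w (b + 1)"] close[of "b + 1"] by (simp add: \<mu>_def S_def)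
      have "\<bar>\<kappa> * (\<mu> (v n) - \<mu> w)\<bar> \<le> 1 * \<bar>\<mu> (v n) - \<mu> w\<bar>"
        using \<kappa> by (simp add: abs_mult mult_left_le_one_le)
      then have \<kappa>\<mu>_close: "\<bar>\<kappa> * \<mu> (v n) - \<kappa> * \<mu> w\<bar> \<le> e / 4"
        using \<mu>_close by (simp add: right_diff_distrib)
      have "\<bar>peak (v n) - peak w\<bar> \<le> e / 4"
        unfolding peak_def using close
        by (intro Sup_diff_le ab S_sub v w) (auto simp: S_def)
      moreover have "\<bar>v n t - w t\<bar> \<le> e / 4" if "t \<in> {a..b}" for t
        using close that by (simp add: S_def)
      \<comment> \<open>In the first argument of the maximum three quantities vary, namely
        \<open>w t\<close>, \<open>\<mu> w\<close> and \<open>peak w\<close>, each by at most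
        \<open>e / 4\<close>.\<close>
      ultimately have "\<bar>\<rho> (v n) t - \<rho> w t\<bar> \<le> e / 4 + e / 4 + e / 4" if "t \<in> {a..b}" for t
        using that \<mu>_close \<kappa>\<mu>_close unfolding \<rho>_def by (smt (verit))
      with \<open>0 < e\<close> show ?case by (fastforce simp: dist_real_def)
    qed
  qed
  interpret compact_self_map S \<Phi> "max \<bar>B\<bar> R"
  proof
    show "compact S" by (auto simp: S_def)
    show "\<bar>\<Phi> w x\<bar> \<le> max \<bar>B\<bar> R" if "continuous_on S w" "x \<in> S" for w x
      using bounded[OF \<rho>(1)[OF that(1)], of x] clip[of "\<mu> w + \<epsilon> * (peak (A (\<rho> w)) - \<mu> w)"] that(2) r
      by (auto simp: \<Phi>_def S_def)
    show "\<exists>d>0. \<forall>w. continuous_on S w \<longrightarrow>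
           (\<forall>x\<in>S. \<forall>y\<in>S. dist x y < d \<longrightarrow> \<bar>\<Phi> w x - \<Phi> w y\<bar> < e)" if e: "0 < e" for e
    proof -
      obtain d where "0 < d" and d: "\<forall>v\<in>K. \<forall>s\<in>{a..b}. \<forall>t\<in>{a..b}. dist s t < d \<longrightarrow> \<bar>A v s - A v t\<bar> < e"
        using equicontinuous[OF e] by blast
      show ?thesis
      \<comment> \<open>The bound 1 separates the isolated point \<open>b + 1\<close> from the
        interval, so two close points lie both in the interval or coincide.\<close>
      proof (intro exI[of _ "min d 1"] conjI allI impI ballI)
        fix w :: "real \<Rightarrow> real" and x y assume *: "continuous_on S w" "x \<in> S" "y \<in> S" "dist x y < min d 1"
        then consider "x \<in> {a..b}" "y \<in> {a..b}" | "x = b + 1" "y = b + 1"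
          by (auto simp: S_def dist_real_def)
        then show "\<bar>\<Phi> w x - \<Phi> w y\<bar> < e"
        proof cases
          case 1
          then have "\<bar>A (\<rho> w) x - A (\<rho> w) y\<bar> < e"
            using d \<rho>(1)[OF *(1)] *(4) by simp
          with 1 show ?thesis by (simp add: \<Phi>_def)
        next
          case 2
          with e show ?thesis by simp
        qed
      qed (use \<open>0 < d\<close> in auto)
    qed
    show "(\<lambda>n. \<Phi> (v n) x) \<longlonglongrightarrow> \<Phi> w x"
      if v: "\<And>n. continuous_on S (v n)" and w: "continuous_on S w"
        and lim: "uniform_limit S v w sequentially" and x: "x \<in> S" for v and w :: "real \<Rightarrow> real" and x
    proof -
      have A_lim: "uniform_limit {a..b} (\<lambda>n. A (\<rho> (v n))) (A (\<rho> w)) sequentially"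
        by (intro continuous \<rho> v w \<rho>_lim lim)
      have peak_lim: "(\<lambda>n. peak (A (\<rho> (v n)))) \<longlonglongrightarrow> peak (A (\<rho> w))"
        unfolding peak_def by (intro tendsto_Sup_uniform ab A_cont \<rho> v w A_lim)
      have "(\<lambda>n. v n (b + 1)) \<longlonglongrightarrow> w (b + 1)"
        using lim by (rule tendsto_uniform_limitI) (simp add: S_def)
      then have "(\<lambda>n. \<mu> (v n)) \<longlonglongrightarrow> \<mu> w"
        unfolding \<mu>_def clip_def by (intro tendsto_intros)
      then show ?thesis
        using tendsto_uniform_limitI[OF A_lim, of x] x peak_lim
        by (cases "x \<le> b") (auto simp: \<Phi>_def clip_def S_def intro!: tendsto_intros)
    qed
  qed
  obtain w where w: "continuous_on S w" and fix_w: "\<forall>x\<in>S. \<Phi> w x = w x"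
    by (rule schauder_fixed_point)
  define v where "v = \<rho> w"
  have vK: "v \<in> K" and peak_v: "peak v = \<mu> w"
    using \<rho>[OF w] by (simp_all add: v_def)
  have wA: "w t = A v t" if "t \<in> {a..b}" for t
    using fix_w that by (auto simp: \<Phi>_def S_def v_def)
  then have peak_w: "peak w = peak (A v)" by (auto simp: peak_def intro!: arg_cong[of _ _ Sup] image_cong)
  have w_end: "w (b + 1) = clip (\<mu> w + \<epsilon> * (peak (A v) - \<mu> w))"
    using fix_w by (auto simp: \<Phi>_def S_def v_def)
  \<comment> \<open>At the fixed point the extra coordinate is itself a clipped value, so clipping
    it once more changes nothing and it equals \<open>\<mu> w\<close>.\<close>
  then have "w (b + 1) \<in> {r..R}"
    by (simp only: clip)
  then have "\<mu> w = w (b + 1)"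
    by (simp add: \<mu>_def clip_def)
  then have \<mu>_eq: "\<mu> w = clip (\<mu> w + \<epsilon> * (peak (A v) - \<mu> w))"
    using w_end by simp
  have "peak (A v) = \<mu> w"
  proof -
    let ?N = "peak (A v)" and ?m = "\<mu> w"
    have "?m = max r (min R (?m + \<epsilon> * (?N - ?m)))"
      using \<mu>_eq unfolding clip_def .
    \<comment> \<open>If the clipping is inactive, equality follows from \<epsilon> being nonzero.
      If it is active, \<open>\<mu> w\<close> is an end of [r, R] and the update points outwards or
      vanishes; the boundary condition gives the reverse inequality.\<close>
    then have clipped: "?m = ?m + \<epsilon> * (?N - ?m) \<or> ?m = r \<and> \<epsilon> * (?N - ?m) \<le> 0 \<or>
        ?m = R \<and> 0 \<le> \<epsilon> * (?N - ?m)"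
      using \<mu>[of w] unfolding atLeastAtMost_iff by linarith
    from \<epsilon> show ?thesis
    proof (elim disjE conjE)
      assume "\<epsilon> = 1" and "\<forall>v\<in>K. (peak v = r \<longrightarrow> r \<le> peak (A v)) \<and> (peak v = R \<longrightarrow> peak (A v) \<le> R)"
      then show ?thesis using clipped vK peak_v by force
    next
      assume "\<epsilon> = -1" and "\<forall>v\<in>K. (peak v = r \<longrightarrow> peak (A v) \<le> r) \<and> (peak v = R \<longrightarrow> R \<le> peak (A v))"
      then show ?thesis using clipped vK peak_v by force
    qed
  qed
  \<comment> \<open>Now the shift in \<rho> is zero, and the cone estimate makes the cut-off idle,
    so \<open>v\<close> agrees with \<open>w\<close>, which is \<open>A v\<close>.\<close>
  then have "A v t = v t" if "t \<in> {a..b}" for t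
    using cone[OF vK that] wA[OF that] peak_w unfolding \<rho>_def v_def peak_def[symmetric] by simp
  with vK show ?thesis by (rule that)
qed

section \<open>The integral operator\<close>

text \<open>The exceptional null set in the hypothesis may depend on \<open>p\<close>. A countable
  dense subset of \<open>B\<close> gives a common one, and continuity extends the inequality to all
  of \<open>B\<close>. This is what permits inserting a point that varies with
  \<open>t\<close>.\<close>

lemma AE_ball_of_ball_AE:
  fixes G :: "'b \<Rightarrow> 'a::{metric_space, second_countable_topology} \<Rightarrow> real"
  assumes cont: "AE t in M. continuous_on UNIV (G t)"
    and nonneg: "\<And>p. p \<in> B \<Longrightarrow> AE t in M. 0 \<le> G t p"
  shows "AE t in M. \<forall>p\<in>B. 0 \<le> G t p"
proof -
  obtain D where D: "countable D" "D \<subseteq> B" "B \<subseteq> closure D"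
    by (metis separable)
  have "AE t in M. \<forall>p\<in>D. 0 \<le> G t p"
    using D nonneg by (subst AE_ball_countable) auto
  with cont show ?thesis
  proof eventually_elim
    case (elim t)
    then have "continuous_on (closure D) (G t)"
      using continuous_on_subset by blast
    with elim D(3) show ?case
      by (blast intro: continuous_ge_on_closure)
  qed
qed

text \<open>For a simple function in place of \<open>u\<close> the composition is pieced together
  from countably many measurable functions. Simple functions converging pointwise to
  \<open>u\<close> and continuity in the second argument give the general case.\<close>

lemma borel_measurable_superposition:
  fixes G :: "'b \<Rightarrow> 'a::{metric_space, second_countable_topology} \<Rightarrow> real"
  assumes cont: "\<And>t. t \<in> space M \<Longrightarrow> continuous_on UNIV (G t)"
    and meas: "\<And>p. (\<lambda>t. G t p) \<in> borel_measurable M"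
    and u: "u \<in> borel_measurable M"
  shows "(\<lambda>t. G t (u t)) \<in> borel_measurable M"
proof -
  obtain s where s: "\<And>i. simple_function M (s i)" and lim: "\<And>t. t \<in> space M \<Longrightarrow> (\<lambda>i. s i t) \<longlonglongrightarrow> u t"
    using borel_measurable_implies_sequence_metric[OF u] by metis
  show ?thesis
  proof (rule borel_measurable_LIMSEQ_real)
    show "(\<lambda>t. G t (s i t)) \<in> borel_measurable M" for i
    proof (rule measurable_compose_countable'[where I = "s i ` space M"])
      show "countable (s i ` space M)"
        using simple_functionD(1)[OF s] by (rule countable_finite)
      show "s i \<in> measurable M (count_space (s i ` space M))"
        using simple_functionD[OF s] by (auto simp: measurable_count_space_eq2)
    qed (rule meas)
    show "(\<lambda>i. G t (s i t)) \<longlonglongrightarrow> G t (u t)" if "t \<in> space M" for t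
      using continuous_on_tendsto_compose[OF cont[OF that] lim[OF that]] by simp
  qed
qed

text \<open>Truncation towards zero does not increase the absolute value, so \<open>T\<close> may be
  any real number, integer or not.\<close>

lemma trunc_in_Icc:
  assumes "t \<in> {-T..T}"
  shows "trunc t \<in> {-T..T}"
proof (cases "0 \<le> t")
  case True
  then have "0 \<le> real_of_int \<lfloor>t\<rfloor>" by simp
  with True assms show ?thesis
    unfolding trunc_def atLeastAtMost_iff by (simp; linarith)
next
  case False
  then have "real_of_int \<lceil>t\<rceil> \<le> 0" by simp
  with False assms show ?thesis
    unfolding trunc_def atLeastAtMost_iff by (simp; linarith)
qed

lemma borel_measurable_trunc [measurable]: "trunc \<in> borel_measurable borel"
  unfolding trunc_def by measurable

abbreviation delayed :: "(real \<Rightarrow> real) \<Rightarrow> real \<Rightarrow> real \<times> real \<times> real" where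
  "delayed v t \<equiv> (v t, v (- t), v (trunc t))"

text \<open>Lebesgue measurability is not stable under composition in general, so the argument runs
  through Borel functions: \<open>v\<close> is extended by zero, and reflection and truncation are
  Borel maps that keep the interval invariant.\<close>

lemma borel_measurable_delayed:
  assumes "continuous_on {-T..T} v"
  shows "delayed v \<in> borel_measurable (lebesgue_on {-T..T})"
proof -
  define w where "w t = indicator {-T..T} t *\<^sub>R v t" for t
  have [measurable]: "w \<in> borel_measurable borel"
    unfolding w_def using assms by (intro borel_measurable_continuous_on_indicator) auto
  have "delayed w \<in> borel_measurable borel"
    by measurable
  then have "delayed w \<in> borel_measurable (lebesgue_on {-T..T})"
    by (intro measurable_restrict_space1 measurable_completion) simp
  moreover have "delayed w t = delayed v t" if "t \<in> space (lebesgue_on {-T..T})" for t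
    using that trunc_in_Icc[of t T] by (auto simp: w_def)
  ultimately show ?thesis
    using measurable_cong[of "lebesgue_on {-T..T}" "delayed w" "delayed v"] by blast
qed

text \<open>The integral operator is studied apart from the differential equation. \<open>G\<close>
  stands for the shifted nonlinearity after correction on a null set, and \<open>{c..d}\<close> is
  the range of values on which its sign and its integrable bound \<open>h\<close> are known.\<close>

locale hammerstein =
  fixes T l L c d :: real and H :: "real \<Rightarrow> real \<Rightarrow> real"
    and G :: "real \<Rightarrow> real \<times> real \<times> real \<Rightarrow> real" and h :: "real \<Rightarrow> real"
  assumes T: "0 < T"
    and H_cont: "continuous_on ({-T..T} \<times> {-T..T}) (\<lambda>(t, s). H t s)"
    and H_bounds: "\<And>t s. t \<in> {-T..T} \<Longrightarrow> s \<in> {-T..T} \<Longrightarrow> H t s \<in> {l..L}"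
    and l: "0 < l"
    and G_cont: "\<And>t. t \<in> {-T..T} \<Longrightarrow> continuous_on UNIV (G t)"
    and G_meas: "\<And>p. (\<lambda>t. G t p) \<in> borel_measurable (lebesgue_on {-T..T})"
    and h: "integrable (lebesgue_on {-T..T}) h"
    and G_bound: "AE t in lebesgue_on {-T..T}. \<forall>p\<in>{c..d} \<times> {c..d} \<times> {c..d}. 0 \<le> G t p \<and> G t p \<le> h t"
begin

abbreviation leb :: "real measure" where
  "leb \<equiv> lebesgue_on {-T..T}"

definition J :: "(real \<Rightarrow> real) \<Rightarrow> real \<Rightarrow> real" where
  "J v s = G s (delayed v s)"

definition A :: "(real \<Rightarrow> real) \<Rightarrow> real \<Rightarrow> real" where
  "A v t = (\<integral>s. H t s * J v s \<partial>leb)"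

definition admissible :: "(real \<Rightarrow> real) set" where
  "admissible = {v. continuous_on {-T..T} v \<and> v ` {-T..T} \<subseteq> {c..d}}"

lemma l_le_L: "l \<le> L"
  using H_bounds[of 0 0] T by auto

lemma space_leb: "space leb = {-T..T}"
  by simp

lemma finite_measure_leb: "finite_measure leb"
  by (rule finite_measure_lebesgue_on) (simp add: lmeasurable_interval)

lemma measure_leb: "measure leb (space leb) = 2 * T"
  using T by (simp add: measure_restrict_space)

lemma delayed_mem:
  assumes "v \<in> admissible" "s \<in> {-T..T}"
  shows "delayed v s \<in> {c..d} \<times> {c..d} \<times> {c..d}"
  using assms trunc_in_Icc[of s T] unfolding admissible_def image_subset_iff by (simp del: atLeastAtMost_iff) auto

lemma J_meas: "J v \<in> borel_measurable leb" if "v \<in> admissible"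
proof -
  have "continuous_on {-T..T} v" using that by (simp add: admissible_def)
  then have "(\<lambda>s. G s (delayed v s)) \<in> borel_measurable leb"
    using G_cont by (intro borel_measurable_superposition[OF _ G_meas borel_measurable_delayed]) simp_all
  then show ?thesis by (simp add: J_def[abs_def])
qed

lemma J_bound: "AE s in leb. 0 \<le> J v s \<and> J v s \<le> h s" if v: "v \<in> admissible"
  using G_bound AE_space
proof eventually_elim
  case (elim s)
  then show ?case using delayed_mem[OF v, of s] by (simp only: J_def space_leb)
qed

lemma J_integrable: "integrable leb (J v)" if "v \<in> admissible"
  by (rule Bochner_Integration.integrable_bound[OF h J_meas[OF that]])
     (use J_bound[OF that] in \<open>eventually_elim; auto\<close>)

lemma H_meas: "H t \<in> borel_measurable leb" if "t \<in> {-T..T}"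
proof -
  have "continuous_on {-T..T} (\<lambda>s. (\<lambda>(t, s). H t s) (t, s))"
    using that by (intro continuous_on_compose2[OF H_cont] continuous_intros) auto
  then show ?thesis by (intro continuous_imp_measurable_on_sets_lebesgue) auto
qed

lemma H_times_integrable:
  assumes t: "t \<in> {-T..T}" and g: "integrable leb g"
  shows "integrable leb (\<lambda>s. H t s * g s)"
proof (rule Bochner_Integration.integrable_bound)
  show "integrable leb (\<lambda>s. L * g s)" using g by simp
  show "(\<lambda>s. H t s * g s) \<in> borel_measurable leb"
    using H_meas[OF t] g by (intro borel_measurable_times) auto
  show "AE s in leb. norm (H t s * g s) \<le> norm (L * g s)"
    using AE_space
  proof eventually_elim
    case (elim s)
    then show ?case
      using H_bounds[OF t, of s] l by (auto simp: abs_mult intro!: mult_right_mono)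
  qed
qed

text \<open>Both bounds contain the same integral. Eliminating it gives
  \<open>A v t \<ge> l / L * A v s\<close> for all \<open>s\<close> and \<open>t\<close> in the
  interval, which is the cone property with ratio \<open>l / L\<close>.\<close>

lemma A_bounds:
  assumes v: "v \<in> admissible" and t: "t \<in> {-T..T}"
  shows "l * integral\<^sup>L leb (J v) \<le> A v t" "A v t \<le> L * integral\<^sup>L leb (J v)"
proof -
  have AE: "AE s in leb. l * J v s \<le> H t s * J v s" "AE s in leb. H t s * J v s \<le> L * J v s"
    using J_bound[OF v] AE_space
    by (eventually_elim, use H_bounds[OF t] in \<open>auto intro!: mult_right_mono\<close>)+
  note int = J_integrable[OF v] H_times_integrable[OF t J_integrable[OF v]]
  have "(\<integral>s. l * J v s \<partial>leb) \<le> A v t"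
    unfolding A_def using int by (intro integral_mono_AE AE) auto
  then show "l * integral\<^sup>L leb (J v) \<le> A v t" by simp
  have "A v t \<le> (\<integral>s. L * J v s \<partial>leb)"
    unfolding A_def using int by (intro integral_mono_AE AE) auto
  then show "A v t \<le> L * integral\<^sup>L leb (J v)" by simp
qed

lemma integral_J_ge:
  assumes "v \<in> admissible" "AE s in leb. k \<le> J v s"
  shows "2 * T * k \<le> integral\<^sup>L leb (J v)"
proof -
  interpret finite_measure leb by (rule finite_measure_leb)
  have "(\<integral>s. k \<partial>leb) \<le> integral\<^sup>L leb (J v)"
    using assms J_integrable by (intro integral_mono_AE) auto
  then show ?thesis using measure_leb by simp
qed

lemma integral_J_le:
  assumes "v \<in> admissible" "AE s in leb. J v s \<le> k"
  shows "integral\<^sup>L leb (J v) \<le> 2 * T * k"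
proof -
  interpret finite_measure leb by (rule finite_measure_leb)
  have "integral\<^sup>L leb (J v) \<le> (\<integral>s. k \<partial>leb)"
    using assms J_integrable by (intro integral_mono_AE) auto
  then show ?thesis using measure_leb by simp
qed

lemma integral_J_mem: "0 \<le> integral\<^sup>L leb (J v)" "integral\<^sup>L leb (J v) \<le> integral\<^sup>L leb h"
  if v: "v \<in> admissible"
proof -
  show "0 \<le> integral\<^sup>L leb (J v)"
    using J_bound[OF v] by (intro integral_nonneg_AE) auto
  show "integral\<^sup>L leb (J v) \<le> integral\<^sup>L leb h"
    using J_bound[OF v] J_integrable[OF v] h by (intro integral_mono_AE) auto
qed

text \<open>The kernel is uniformly continuous on the compact square, and the integrals of
  \<open>J v\<close> are bounded by that of \<open>h\<close> uniformly in \<open>v\<close>.\<close>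

lemma A_equicontinuous:
  assumes "0 < e"
  shows "\<exists>\<delta>>0. \<forall>v\<in>admissible. \<forall>s\<in>{-T..T}. \<forall>t\<in>{-T..T}. dist s t < \<delta> \<longrightarrow> \<bar>A v s - A v t\<bar> < e"
proof -
  define C where "C = \<bar>integral\<^sup>L leb h\<bar> + 1"
  have C: "0 < C" by (simp add: C_def)
  have "uniformly_continuous_on ({-T..T} \<times> {-T..T}) (\<lambda>(t, s). H t s)"
    by (intro compact_uniformly_continuous H_cont compact_Times) auto
  moreover have "0 < e / C" using assms C by simp
  ultimately obtain \<delta> where "0 < \<delta>" and \<delta>: "\<forall>p\<in>{-T..T} \<times> {-T..T}. \<forall>q\<in>{-T..T} \<times> {-T..T}.
      dist q p < \<delta> \<longrightarrow> dist (case q of (t, s) \<Rightarrow> H t s) (case p of (t, s) \<Rightarrow> H t s) < e / C"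
    unfolding uniformly_continuous_on_def by blast
  have "\<bar>A v s - A v t\<bar> < e"
    if v: "v \<in> admissible" and s: "s \<in> {-T..T}" and t: "t \<in> {-T..T}" and "dist s t < \<delta>" for v s t
  proof -
    have close: "\<bar>H s x - H t x\<bar> \<le> e / C" if "x \<in> {-T..T}" for x
      using \<delta>[rule_format, of "(t, x)" "(s, x)"] s t that \<open>dist s t < \<delta>\<close>
      by (auto simp: dist_Pair_Pair dist_real_def)
    note int = H_times_integrable[OF s J_integrable[OF v]] H_times_integrable[OF t J_integrable[OF v]]
    have "\<bar>A v s - A v t\<bar> = \<bar>\<integral>x. H s x * J v x - H t x * J v x \<partial>leb\<bar>"
      using int by (simp add: A_def)
    also have "\<dots> \<le> (\<integral>x. \<bar>H s x * J v x - H t x * J v x\<bar> \<partial>leb)"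
      by (rule integral_abs_bound)
    also have "\<dots> \<le> (\<integral>x. e / C * J v x \<partial>leb)"
    proof (rule integral_mono_AE)
      show "AE x in leb. \<bar>H s x * J v x - H t x * J v x\<bar> \<le> e / C * J v x"
        using J_bound[OF v] AE_space
      proof eventually_elim
        case (elim x)
        then show ?case using close[of x]
          by (auto simp: abs_mult simp flip: left_diff_distrib intro!: mult_right_mono simp del: times_divide_eq_left)
      qed
    qed (use int J_integrable[OF v] in auto)
    also have "\<dots> = e / C * integral\<^sup>L leb (J v)" by simp
    also have "\<dots> < e / C * C"
      using integral_J_mem[OF v] assms C by (intro mult_strict_left_mono) (auto simp: C_def)
    finally show ?thesis using C by simp
  qed
  with \<open>0 < \<delta>\<close> show ?thesis by blast
qed

text \<open>Dominated convergence with majorant \<open>2 * h\<close> gives convergence of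
  \<open>J (v n)\<close> to \<open>J w\<close> in the mean. The bound \<open>L\<close> on the kernel
  makes the resulting estimate uniform in \<open>t\<close>.\<close>

lemma A_continuous:
  assumes v: "\<And>n. v n \<in> admissible" and w: "w \<in> admissible" and lim: "uniform_limit {-T..T} v w sequentially"
  shows "uniform_limit {-T..T} (\<lambda>n. A (v n)) (A w) sequentially"
proof -
  have J_lim: "(\<lambda>n. J (v n) s) \<longlonglongrightarrow> J w s" if s: "s \<in> {-T..T}" for s
  proof -
    have "(\<lambda>n. delayed (v n) s) \<longlonglongrightarrow> delayed w s"
      using s trunc_in_Icc[OF s] by (intro tendsto_Pair tendsto_uniform_limitI[OF lim]) auto
    then show ?thesis
      unfolding J_def using continuous_on_tendsto_compose[OF G_cont[OF s]] by simp
  qed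
  have "(\<lambda>n. \<integral>s. \<bar>J (v n) s - J w s\<bar> \<partial>leb) \<longlonglongrightarrow> (\<integral>s. 0 \<partial>leb)"
  proof (rule integral_dominated_convergence[where w = "\<lambda>s. 2 * h s"])
    show "AE s in leb. (\<lambda>n. \<bar>J (v n) s - J w s\<bar>) \<longlonglongrightarrow> 0"
      using AE_space
    proof eventually_elim
      case (elim s)
      then have "(\<lambda>n. \<bar>J (v n) s - J w s\<bar>) \<longlonglongrightarrow> \<bar>J w s - J w s\<bar>"
        by (intro tendsto_intros J_lim) auto
      then show ?case by simp
    qed
    show "AE s in leb. norm \<bar>J (v n) s - J w s\<bar> \<le> 2 * h s" for n
      using J_bound[OF v[of n]] J_bound[OF w] by eventually_elim auto
  qed (use J_meas v w h in auto)
  then have lim0: "(\<lambda>n. L * (\<integral>s. \<bar>J (v n) s - J w s\<bar> \<partial>leb)) \<longlonglongrightarrow> L * 0"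
    by (intro tendsto_intros) auto
  have A_diff: "\<bar>A (v n) t - A w t\<bar> \<le> L * (\<integral>s. \<bar>J (v n) s - J w s\<bar> \<partial>leb)" if t: "t \<in> {-T..T}" for n t
  proof -
    note int = J_integrable[OF v[of n]] J_integrable[OF w]
    have "\<bar>A (v n) t - A w t\<bar> = \<bar>\<integral>s. H t s * J (v n) s - H t s * J w s \<partial>leb\<bar>"
      using H_times_integrable[OF t int(1)] H_times_integrable[OF t int(2)] by (simp add: A_def)
    also have "\<dots> \<le> (\<integral>s. \<bar>H t s * J (v n) s - H t s * J w s\<bar> \<partial>leb)"
      by (rule integral_abs_bound)
    also have "\<dots> \<le> (\<integral>s. L * \<bar>J (v n) s - J w s\<bar> \<partial>leb)"
    proof (rule integral_mono_AE)
      show "AE s in leb. \<bar>H t s * J (v n) s - H t s * J w s\<bar> \<le> L * \<bar>J (v n) s - J w s\<bar>"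
        using AE_space
      proof eventually_elim
        case (elim s)
        then show ?case using H_bounds[OF t, of s] l
          by (auto simp: abs_mult simp flip: right_diff_distrib intro!: mult_right_mono)
      qed
    qed (use int H_times_integrable[OF t int(1)] H_times_integrable[OF t int(2)] in auto)
    finally show ?thesis by simp
  qed
  show ?thesis
  proof (rule uniform_limitI)
    fix e :: real assume "0 < e"
    then have "\<forall>\<^sub>F n in sequentially. L * (\<integral>s. \<bar>J (v n) s - J w s\<bar> \<partial>leb) < e"
      using order_tendstoD(2)[OF lim0] by simp
    then show "\<forall>\<^sub>F n in sequentially. \<forall>t\<in>{-T..T}. dist (A (v n) t) (A w t) < e"
    proof eventually_elim
      case (elim n)
      then show ?case unfolding dist_real_def using A_diff le_less_trans by blast
    qed
  qed
qed

end

section \<open>Growth conditions at the two radii of the annulus\<close>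

context hammerstein
begin

context
  fixes r R :: real
  assumes r: "0 < r" "r < R" and cd: "c = l / L * r" "d = L / l * R"
begin

abbreviation "peak v \<equiv> Sup (v ` {-T..T})" for v :: "real \<Rightarrow> real"

text \<open>The outer radius is \<open>d = L / l * R\<close> and not \<open>R\<close>: a cone
  element with maximum \<open>d\<close> then takes its values in \<open>{R..d}\<close>, the range of
  the second growth condition.\<close>

abbreviation "K \<equiv> cone_annulus (-T) T (l / L) r d"

lemma cone_ranges:
  assumes "v \<in> K" "t \<in> {-T..T}"
  shows "v t \<in> {l / L * peak v..peak v}"
proof -
  have "continuous_on {-T..T} v" using assms(1) by (simp add: cone_annulus_def)
  then have "v t \<le> peak v"
    using continuous_Icc_Sup[of "-T" T v] T assms(2) by (metis neg_le_0_iff_le order.trans less_imp_le)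
  with assms show ?thesis by (simp add: cone_annulus_def)
qed

lemma cone_admissible: "K \<subseteq> admissible"
proof
  fix v assume v: "v \<in> K"
  have "l / L * r \<le> l / L * peak v"
    using v l l_le_L by (intro mult_left_mono) (auto simp: cone_annulus_def)
  then have "c \<le> v t \<and> v t \<le> d" if "t \<in> {-T..T}" for t
    using v cone_ranges[OF v that] by (auto simp: cone_annulus_def cd(1))
  with v show "v \<in> admissible"
    by (auto simp: admissible_def cone_annulus_def)
qed

lemma peak_A_bounds:
  assumes v: "v \<in> admissible"
  shows "l * integral\<^sup>L leb (J v) \<le> peak (A v)" "peak (A v) \<le> L * integral\<^sup>L leb (J v)"
proof -
  have "A v 0 \<le> peak (A v)"
    using A_bounds(2)[OF v] T by (intro cSUP_upper bdd_aboveI2[where M = "L * integral\<^sup>L leb (J v)"]) auto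
  then show "l * integral\<^sup>L leb (J v) \<le> peak (A v)"
    using A_bounds(1)[OF v, of 0] T by simp
  show "peak (A v) \<le> L * integral\<^sup>L leb (J v)"
    using A_bounds(2)[OF v] T by (intro cSUP_least) auto
qed

text \<open>The constant offsets all losses: the cone gives \<open>v \<ge> l / L * q\<close>,
  integration contributes \<open>2 * T\<close> and the kernel at least \<open>l\<close>, and the
  product of these with \<open>L / (2 * T * l ^ 2)\<close> is \<open>q\<close>.\<close>

lemma peak_A_ge:
  assumes v: "v \<in> K" and q: "peak v = q"
    and G_ge: "AE t in leb. \<forall>p\<in>{l / L * q..q} \<times> {l / L * q..q} \<times> {l / L * q..q}.
          L / (2 * T * l ^ 2) * fst p \<le> G t p"
  shows "q \<le> peak (A v)"
proof -
  have v': "v \<in> admissible" using v cone_admissible by blast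
  have "AE s in leb. L / (2 * T * l ^ 2) * (l / L * q) \<le> J v s"
    using G_ge AE_space
  proof eventually_elim
    case (elim s)
    then have s: "s \<in> {-T..T}" "-s \<in> {-T..T}" by auto
    note ranges = cone_ranges[OF v s(1)] cone_ranges[OF v s(2)] cone_ranges[OF v trunc_in_Icc[OF s(1)]]
    then have "L / (2 * T * l ^ 2) * (l / L * q) \<le> L / (2 * T * l ^ 2) * v s"
      using T l l_le_L q by (intro mult_left_mono) auto
    also have "\<dots> \<le> J v s"
      using bspec[OF elim(1), of "delayed v s"] ranges q by (simp add: J_def)
    finally show ?case .
  qed
  from integral_J_ge[OF v' this]
  have "l * (2 * T * (L / (2 * T * l ^ 2) * (l / L * q))) \<le> l * integral\<^sup>L leb (J v)"
    using l by (intro mult_left_mono) auto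
  also have "\<dots> \<le> peak (A v)" by (rule peak_A_bounds[OF v'])
  finally show ?thesis using l l_le_L T by (simp add: power2_eq_square)
qed

text \<open>Here \<open>v \<le> q\<close>, integration contributes \<open>2 * T\<close> and the
  kernel at most \<open>L\<close>, which \<open>1 / (2 * T * L)\<close> cancels.\<close>

lemma peak_A_le:
  assumes v: "v \<in> K" and q: "peak v = q"
    and G_le: "AE t in leb. \<forall>p\<in>{l / L * q..q} \<times> {l / L * q..q} \<times> {l / L * q..q}.
          G t p \<le> 1 / (2 * T * L) * fst p"
  shows "peak (A v) \<le> q"
proof -
  have v': "v \<in> admissible" using v cone_admissible by blast
  have "AE s in leb. J v s \<le> 1 / (2 * T * L) * q"
    using G_le AE_space
  proof eventually_elim
    case (elim s)
    then have s: "s \<in> {-T..T}" "-s \<in> {-T..T}" by auto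
    note ranges = cone_ranges[OF v s(1)] cone_ranges[OF v s(2)] cone_ranges[OF v trunc_in_Icc[OF s(1)]]
    have "J v s \<le> 1 / (2 * T * L) * v s"
      using bspec[OF elim(1), of "delayed v s"] ranges q by (simp add: J_def)
    also have "\<dots> \<le> 1 / (2 * T * L) * q"
      using T l l_le_L q ranges by (intro mult_left_mono) auto
    finally show ?case .
  qed
  from integral_J_le[OF v' this]
  have "L * integral\<^sup>L leb (J v) \<le> L * (2 * T * (1 / (2 * T * L) * q))"
    using l l_le_L by (intro mult_left_mono) auto
  with peak_A_bounds(2)[OF v'] have "peak (A v) \<le> L * (2 * T * (1 / (2 * T * L) * q))"
    by (rule order_trans)
  then show ?thesis using l l_le_L T by simp
qed

theorem fixed_point:
  assumes growth:
    "(AE t in leb. \<forall>p\<in>{l / L * r..r} \<times> {l / L * r..r} \<times> {l / L * r..r}. L / (2 * T * l ^ 2) * fst p \<le> G t p) \<and>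
     (AE t in leb. \<forall>p\<in>{R..d} \<times> {R..d} \<times> {R..d}. G t p \<le> 1 / (2 * T * L) * fst p) \<or>
     (AE t in leb. \<forall>p\<in>{l / L * r..r} \<times> {l / L * r..r} \<times> {l / L * r..r}. G t p \<le> 1 / (2 * T * L) * fst p) \<and>
     (AE t in leb. \<forall>p\<in>{R..d} \<times> {R..d} \<times> {R..d}. L / (2 * T * l ^ 2) * fst p \<le> G t p)"
  obtains v where "v \<in> admissible" "\<And>t. t \<in> {-T..T} \<Longrightarrow> A v t = v t"
proof -
  note result = that
  have pos: "0 < L" "0 < T" "0 < l" using l l_le_L T by auto
  \<comment> \<open>This turns the interval \<open>{l / L * d..d}\<close> of the estimates at radius
    \<open>d\<close> into \<open>{R..d}\<close>.\<close>
  have \<kappa>d: "l / L * d = R" using pos by (simp add: cd)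
  have "1 * R \<le> L / l * R" using pos l_le_L r by (intro mult_right_mono) auto
  then have rd: "r \<le> d" using r by (simp add: cd)
  show ?thesis
  proof (rule krasnoselskii_fixed_point[of "-T" T "l / L" r d A "L * integral\<^sup>L leb h"])
    show "\<bar>A v t\<bar> \<le> L * integral\<^sup>L leb h" if "v \<in> K" "t \<in> {-T..T}" for v t
    proof -
      have v: "v \<in> admissible" using that cone_admissible by blast
      have "0 \<le> l * integral\<^sup>L leb (J v)" "L * integral\<^sup>L leb (J v) \<le> L * integral\<^sup>L leb h"
        using integral_J_mem[OF v] pos by auto
      then show ?thesis using A_bounds[OF v that(2)] by linarith
    qed
    show "l / L * peak (A v) \<le> A v t" if "v \<in> K" "t \<in> {-T..T}" for v t
    proof -
      have v: "v \<in> admissible" using that cone_admissible by blast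
      have "l / L * peak (A v) \<le> l / L * (L * integral\<^sup>L leb (J v))"
        using peak_A_bounds(2)[OF v] pos by (intro mult_left_mono) auto
      then show ?thesis using A_bounds(1)[OF v that(2)] pos by simp
    qed
    show "\<exists>\<delta>>0. \<forall>v\<in>K. \<forall>s\<in>{-T..T}. \<forall>t\<in>{-T..T}. dist s t < \<delta> \<longrightarrow> \<bar>A v s - A v t\<bar> < e" if "0 < e" for e
      using A_equicontinuous[OF that] cone_admissible by blast
    show "uniform_limit {-T..T} (\<lambda>n. A (v n)) (A w) sequentially"
      if "\<And>n. v n \<in> K" "w \<in> K" "uniform_limit {-T..T} v w sequentially" for v w
      using that cone_admissible by (intro A_continuous) auto
    show "(\<forall>v\<in>K. (peak v = r \<longrightarrow> r \<le> peak (A v)) \<and> (peak v = d \<longrightarrow> peak (A v) \<le> d)) \<or>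
          (\<forall>v\<in>K. (peak v = r \<longrightarrow> peak (A v) \<le> r) \<and> (peak v = d \<longrightarrow> d \<le> peak (A v)))"
      using growth
    proof (elim disjE conjE, goal_cases)
      case 1
      then show ?case
        using peak_A_ge[of _ r] peak_A_le[of _ d] unfolding \<kappa>d by blast
    next
      case 2
      then show ?case
        using peak_A_le[of _ r] peak_A_ge[of _ d] unfolding \<kappa>d by blast
    qed
    show "thesis" if "v \<in> K" "\<And>t. t \<in> {-T..T} \<Longrightarrow> A v t = v t" for v
      using that cone_admissible by (intro result) auto
  qed (use pos l_le_L r rd in auto)
qed

end

end

section \<open>The periodic problem\<close>

text \<open>\<open>GREATEST\<close> is a description operator and says something only where a
  greatest element exists; compactness supplies it.\<close>

lemma compact_image_GREATEST:
  fixes f :: "'a::topological_space \<Rightarrow> real"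
  assumes "compact S" "continuous_on S f" "x \<in> S"
  shows "f x \<le> (GREATEST y. y \<in> f ` S)"
proof -
  obtain p where "p \<in> S" "\<forall>y\<in>S. f y \<le> f p"
    using continuous_attains_sup[of S f] assms by blast
  then have "(GREATEST y. y \<in> f ` S) = f p"
    by (intro Greatest_equality) auto
  with assms \<open>\<forall>y\<in>S. f y \<le> f p\<close> show ?thesis by simp
qed

lemma compact_image_LEAST:
  fixes f :: "'a::topological_space \<Rightarrow> real"
  assumes "compact S" "continuous_on S f" "S \<noteq> {}"
  shows "(LEAST y. y \<in> f ` S) \<in> f ` S" "x \<in> S \<Longrightarrow> (LEAST y. y \<in> f ` S) \<le> f x"
proof -
  obtain p where p: "p \<in> S" "\<forall>y\<in>S. f p \<le> f y"
    using continuous_attains_inf[of S f] assms by blast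
  then have "(LEAST y. y \<in> f ` S) = f p"
    by (intro Least_equality) auto
  with p show "(LEAST y. y \<in> f ` S) \<in> f ` S" "x \<in> S \<Longrightarrow> (LEAST y. y \<in> f ` S) \<le> f x"
    by auto
qed

theorem theorem7p2:
  fixes T m M L l r R :: real
    and f :: "real \<Rightarrow> real \<Rightarrow> real \<Rightarrow> real \<Rightarrow> real"
    and H :: "real \<Rightarrow> real \<Rightarrow> real"
  assumes "T > 0"
    and "\<forall>x y z. f (- T) x y z = f T x y z"
    and "caratheodory T f"
    and "is_green_function T m M H"
    and "\<forall>t\<in>{-T..T}. \<forall>s\<in>{-T..T}. H t s > 0"
    and "L = (GREATEST x. x \<in> (\<lambda>(t, s). H t s) ` ({-T..T} \<times> {-T..T}))"
    and "l = (LEAST x. x \<in> (\<lambda>(t, s). H t s) ` ({-T..T} \<times> {-T..T}))"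
    and "0 < r" and "r < R"
    and "\<forall>x\<in>{l / L * r..L / l * R}. \<forall>y\<in>{l / L * r..L / l * R}. \<forall>z\<in>{l / L * r..L / l * R}.
           AE t in lebesgue_on {-T..T}. f t x y z + m * y + M * z \<ge> 0"
    and "((\<forall>x\<in>{l / L * r..r}. \<forall>y\<in>{l / L * r..r}. \<forall>z\<in>{l / L * r..r}.
            AE t in lebesgue_on {-T..T}.
              f t x y z + m * y + M * z \<ge> L / (2 * T * l ^ 2) * x) \<and>
          (\<forall>x\<in>{R..L / l * R}. \<forall>y\<in>{R..L / l * R}. \<forall>z\<in>{R..L / l * R}.
            AE t in lebesgue_on {-T..T}.
              f t x y z + m * y + M * z \<le> 1 / (2 * T * L) * x)) \<or>
         ((\<forall>x\<in>{l / L * r..r}. \<forall>y\<in>{l / L * r..r}. \<forall>z\<in>{l / L * r..r}.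
            AE t in lebesgue_on {-T..T}.
              f t x y z + m * y + M * z \<le> 1 / (2 * T * L) * x) \<and>
          (\<forall>x\<in>{R..L / l * R}. \<forall>y\<in>{R..L / l * R}. \<forall>z\<in>{R..L / l * R}.
            AE t in lebesgue_on {-T..T}.
              f t x y z + m * y + M * z \<ge> L / (2 * T * l ^ 2) * x))"
  shows "\<exists>v. nonlinear_solution T f v \<and> (\<forall>t\<in>{-T..T}. v t > 0)"
proof -
  let ?leb = "lebesgue_on {-T..T}"
  let ?c = "l / L * r" and ?d = "L / l * R"
  let ?I2 = "{-T..T} \<times> {-T..T}"
  have H_cont: "continuous_on ?I2 (\<lambda>(t, s). H t s)"
    using assms(4) by (simp add: is_green_function_def)
  have compact: "compact ?I2" "?I2 \<noteq> {}"
    using \<open>T > 0\<close> by (auto intro: compact_Times)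
  have H_bounds: "H t s \<in> {l..L}" if "t \<in> {-T..T}" "s \<in> {-T..T}" for t s
    using compact_image_GREATEST[OF compact(1) H_cont, of "(t, s)"]
      compact_image_LEAST(2)[OF compact(1) H_cont compact(2), of "(t, s)"] that assms(6,7) by auto
  \<comment> \<open>The minimum is a value of the kernel, so pointwise positivity carries over to
    it.\<close>
  have "l > 0"
    using compact_image_LEAST(1)[OF compact(1) H_cont compact(2)] assms(5) unfolding assms(7)[symmetric] by auto
  then have "0 < L" using H_bounds[of 0 0] \<open>T > 0\<close> by auto

  define F where "F t p = (case p of (x, y, z) \<Rightarrow> f t x y z + m * y + M * z)" for t p
  have F_cont: "AE t in ?leb. continuous_on UNIV (F t)"
  proof -
    have "AE t in ?leb. continuous_on UNIV (\<lambda>(x, y, z). f t x y z)"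
      using assms(3) by (simp add: caratheodory_def)
    then show ?thesis
      by eventually_elim (auto simp: F_def case_prod_unfold intro!: continuous_intros)
  qed
  have F_meas: "(\<lambda>t. F t p) \<in> borel_measurable ?leb" for p
  proof (cases p)
    case (fields x y z)
    have "(\<lambda>t. f t x y z) \<in> borel_measurable ?leb"
      using assms(3) by (simp add: caratheodory_def)
    then show ?thesis by (simp add: F_def fields)
  qed
  \<comment> \<open>The growth hypotheses hold for each triple with its own null set. Passing to a
    common null set makes them applicable along a function.\<close>
  have F_ge: "AE t in ?leb. \<forall>p\<in>B \<times> B \<times> B. k * fst p \<le> F t p"
    if "\<forall>x\<in>B. \<forall>y\<in>B. \<forall>z\<in>B. AE t in ?leb. k * x \<le> f t x y z + m * y + M * z" for B k
  proof -
    have "AE t in ?leb. \<forall>p\<in>B \<times> B \<times> B. 0 \<le> F t p - k * fst p"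
    proof (rule AE_ball_of_ball_AE)
      show "AE t in ?leb. continuous_on UNIV (\<lambda>p. F t p - k * fst p)"
        using F_cont by eventually_elim (intro continuous_intros)
    qed (use that in \<open>auto simp: F_def\<close>)
    then show ?thesis by simp
  qed
  have F_le: "AE t in ?leb. \<forall>p\<in>B \<times> B \<times> B. F t p \<le> k * fst p"
    if "\<forall>x\<in>B. \<forall>y\<in>B. \<forall>z\<in>B. AE t in ?leb. f t x y z + m * y + M * z \<le> k * x" for B k
  proof -
    have "AE t in ?leb. \<forall>p\<in>B \<times> B \<times> B. 0 \<le> k * fst p - F t p"
    proof (rule AE_ball_of_ball_AE)
      show "AE t in ?leb. continuous_on UNIV (\<lambda>p. k * fst p - F t p)"
        using F_cont by eventually_elim (intro continuous_intros)
    qed (use that in \<open>auto simp: F_def\<close>)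
    then show ?thesis by simp
  qed
  have d_pos: "0 < ?d" and c_pos: "0 < ?c" using \<open>0 < l\<close> \<open>0 < L\<close> assms(8,9) by auto
  \<comment> \<open>The Caratheodory bound concerns strict inequalities, so the radius must exceed
    \<open>?d\<close> to cover the closed cube.\<close>
  have "0 < ?d + 1" using d_pos by simp
  moreover have "\<forall>\<rho>>0. \<exists>h. set_integrable lebesgue {-T..T} h \<and>
      (\<forall>x y z. \<bar>x\<bar> < \<rho> \<and> \<bar>y\<bar> < \<rho> \<and> \<bar>z\<bar> < \<rho> \<longrightarrow> (AE t in ?leb. \<bar>f t x y z\<bar> \<le> h t))"
    using assms(3) unfolding caratheodory_def by (elim conjE)
  ultimately obtain h0 where h0: "set_integrable lebesgue {-T..T} h0"
    and h0_all: "\<forall>x y z. \<bar>x\<bar> < ?d + 1 \<and> \<bar>y\<bar> < ?d + 1 \<and> \<bar>z\<bar> < ?d + 1 \<longrightarrow>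
      (AE t in ?leb. \<bar>f t x y z\<bar> \<le> h0 t)"
    by (elim allE[where x = "?d + 1"] impE) (assumption, elim exE conjE)
  \<comment> \<open>The added constant dominates \<open>m * y + M * z\<close> on the cube and is
    integrable because the interval has finite measure.\<close>
  define h where "h t = h0 t + (\<bar>m\<bar> * ?d + \<bar>M\<bar> * ?d)" for t
  have h: "integrable ?leb h"
  proof -
    interpret finite_measure ?leb
      by (rule finite_measure_lebesgue_on) (simp add: lmeasurable_interval)
    have "integrable ?leb h0"
      using h0 by (simp add: set_integrable_def integrable_restrict_space)
    then show ?thesis by (simp add: h_def[abs_def])
  qed
  have F_bound: "AE t in ?leb. \<forall>p\<in>{?c..?d} \<times> {?c..?d} \<times> {?c..?d}. 0 \<le> h t - F t p"
  proof (rule AE_ball_of_ball_AE)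
    show "AE t in ?leb. continuous_on UNIV (\<lambda>p. h t - F t p)"
      using F_cont by eventually_elim (intro continuous_intros)
    fix p assume "p \<in> {?c..?d} \<times> {?c..?d} \<times> {?c..?d}"
    then obtain x y z where p: "p = (x, y, z)" and xyz: "x \<in> {?c..?d}" "y \<in> {?c..?d}" "z \<in> {?c..?d}"
      by blast
    have "AE t in ?leb. \<bar>f t x y z\<bar> \<le> h0 t"
      using xyz c_pos by (intro h0_all[rule_format]) auto
    then show "AE t in ?leb. 0 \<le> h t - F t p"
    proof eventually_elim
      case (elim t)
      have "m * y \<le> \<bar>m\<bar> * ?d" "M * z \<le> \<bar>M\<bar> * ?d"
        using xyz c_pos by (intro mult_mono; simp)+
      with elim show ?case by (simp add: h_def F_def p)
    qed
  qed

  obtain N where N: "N \<in> null_sets ?leb" and N_cont: "\<And>t. t \<in> {-T..T} \<Longrightarrow> t \<notin> N \<Longrightarrow> continuous_on UNIV (F t)"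
    using F_cont by (auto simp: eventually_ae_filter)
  text \<open>On the null set where \<open>F t\<close> may be discontinuous it is replaced by \<open>0\<close>, which makes
    superposition measurable without appealing to completeness of the measure.\<close>
  define G where "G t p = (if t \<in> N then 0 else F t p)" for t p
  have GF: "AE t in ?leb. G t = F t"
    using AE_not_in[OF N] by eventually_elim (simp add: G_def fun_eq_iff)
  interpret hammerstein T l L ?c ?d H G h
  proof
    show "continuous_on UNIV (G t)" if "t \<in> {-T..T}" for t
      using N_cont[OF that] by (cases "t \<in> N") (simp_all add: G_def[abs_def])
    show "(\<lambda>t. G t p) \<in> borel_measurable ?leb" for p
      unfolding G_def using N F_meas[of p] by (intro measurable_If_set) auto
    \<comment> \<open>Nonnegativity is the lower growth bound with slope 0.\<close>
    have "AE t in ?leb. \<forall>p\<in>{?c..?d} \<times> {?c..?d} \<times> {?c..?d}. 0 * fst p \<le> F t p"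
      using assms(10) by (intro F_ge) simp
    with F_bound GF show "AE t in ?leb. \<forall>p\<in>{?c..?d} \<times> {?c..?d} \<times> {?c..?d}. 0 \<le> G t p \<and> G t p \<le> h t"
      by eventually_elim auto
  qed (fact \<open>0 < T\<close> H_cont H_bounds \<open>0 < l\<close> h)+
  have G_ge: "AE t in ?leb. \<forall>p\<in>B \<times> B \<times> B. k * fst p \<le> G t p"
    if "\<forall>x\<in>B. \<forall>y\<in>B. \<forall>z\<in>B. AE t in ?leb. k * x \<le> f t x y z + m * y + M * z" for B k
    using F_ge[OF that] GF by eventually_elim simp
  have G_le: "AE t in ?leb. \<forall>p\<in>B \<times> B \<times> B. G t p \<le> k * fst p"
    if "\<forall>x\<in>B. \<forall>y\<in>B. \<forall>z\<in>B. AE t in ?leb. f t x y z + m * y + M * z \<le> k * x" for B k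
    using F_le[OF that] GF by eventually_elim simp
  obtain v where v: "v \<in> admissible" and fixed: "\<And>t. t \<in> {-T..T} \<Longrightarrow> A v t = v t"
  proof (rule fixed_point[OF assms(8,9) refl refl])
    show "(AE t in ?leb. \<forall>p\<in>{?c..r} \<times> {?c..r} \<times> {?c..r}. L / (2 * T * l ^ 2) * fst p \<le> G t p) \<and>
      (AE t in ?leb. \<forall>p\<in>{R..?d} \<times> {R..?d} \<times> {R..?d}. G t p \<le> 1 / (2 * T * L) * fst p) \<or>
      (AE t in ?leb. \<forall>p\<in>{?c..r} \<times> {?c..r} \<times> {?c..r}. G t p \<le> 1 / (2 * T * L) * fst p) \<and>
      (AE t in ?leb. \<forall>p\<in>{R..?d} \<times> {R..?d} \<times> {R..?d}. L / (2 * T * l ^ 2) * fst p \<le> G t p)"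
      using assms(11)
      by (elim disjE conjE) (blast intro: G_ge G_le)+
  qed (rule that)
  have J_eq: "AE t in ?leb. J v t = f t (v t) (v (- t)) (v (trunc t)) + m * v (- t) + M * v (trunc t)"
    using GF by eventually_elim (simp add: J_def F_def)
  \<comment> \<open>The defining property of the Green's function with right-hand side
    \<open>J v\<close> provides the regularity of \<open>A v\<close>, the linear equation and the
    boundary conditions.\<close>
  have "set_integrable lebesgue {-T..T} (J v)"
    using J_integrable[OF v] by (simp add: set_integrable_def integrable_restrict_space)
  moreover have "(\<lambda>t. LINT s:{-T..T}|lebesgue. H t s * J v s) = A v"
    by (simp add: fun_eq_iff A_def set_lebesgue_integral_def integral_restrict_space)
  ultimately have "linear_solution T m M (J v) (A v)"
    using assms(4) unfolding is_green_function_def by metis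
  then obtain v' v'' where derivs: "derivs_on T (A v) v' v''"
    and eq: "AE t in ?leb. v'' t + m * A v (- t) + M * A v (trunc t) = J v t"
    and bc: "A v (- T) = A v T" "v' T = v' (- T)"
    by (auto simp: linear_solution_def)
  \<comment> \<open>On the interval \<open>A v\<close> equals \<open>v\<close>, also at the
    reflected and truncated points, so the terms with \<open>m\<close> and \<open>M\<close> cancel.
    The solution is \<open>A v\<close> itself, since \<open>v\<close> is known to agree with it on
    the interval only.\<close>
  have "AE t in ?leb. v'' t = f t (A v t) (A v (- t)) (A v (trunc t))"
    using eq J_eq AE_space
  proof eventually_elim
    case (elim t)
    then have "t \<in> {-T..T}" "-t \<in> {-T..T}" by auto
    with elim show ?case using fixed trunc_in_Icc[of t T] by simp
  qed
  with derivs bc(1) bc(2)[symmetric] have "nonlinear_solution T f (A v)"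
    unfolding nonlinear_solution_def by blast
  moreover have "0 < A v t" if "t \<in> {-T..T}" for t
  proof -
    have "v t \<in> {?c..?d}" using v that unfolding admissible_def by blast
    with fixed[OF that] c_pos show ?thesis by simp
  qed
  ultimately show ?thesis by blast
qed

end
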